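(* Let $0<|q|<1$ and fix a square root $q^{1/2}$. With the notation of the context, the following operator identities hold on the fermionic Fock space. (i) For every integer $k>0$ and every $m\in\mathbb{Z}$, $$\Gamma_{+}(q^{-\rho})\Big(V^{(k)}_m-\frac{q^k}{1-q^k}\delta_{m,0}\Big)\Gamma_{+}(q^{-\rho})^{-1}=(-1)^k\,\Gamma_{-}(q^{-\rho})^{-1}\Big(V^{(k)}_{m+k}-\frac{q^k}{1-q^k}\delta_{m+k,0}\Big)\Gamma_{-}(q^{-\rho}).$$ (ii) For every integer $k>0$ and every $m\in\mathbb{Z}$, $$\Gamma'_{+}(q^{-\rho})\Big(V^{(-k)}_m+\frac{1}{1-q^k}\delta_{m,0}\Big)\Gamma'_{+}(q^{-\rho})^{-1}=\Gamma'_{-}(q^{-\rho})^{-1}\Big(V^{(-k)}_{m+k}+\frac{1}{1-q^k}\delta_{m+k,0}\Big)\Gamma'_{-}(q^{-\rho}).$$ (iii) For all $k,m\in\mathbb{Z}$, $$q^{W_0/2}\,V^{(k)}_m\,q^{-W_0/2}=V^{(k-m)}_m .$$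
   Context: Let $\psi_n,\psi^*_n$ ($n\in\mathbb{Z}$) be complex free fermion modes satisfying $\psi_m\psi^*_n+\psi^*_n\psi_m=\delta_{m+n,0}$, $\psi_m\psi_n+\psi_n\psi_m=0$, $\psi^*_m\psi^*_n+\psi^*_n\psi^*_m=0$, acting on the fermionic Fock space built on the vacuum $|0\rangle$ with $\psi_n|0\rangle=0$ for $n\ge 0$ and $\psi^*_n|0\rangle=0$ for $n\ge 1$. Normal ordering of bilinears is $:\psi_m\psi^*_n:=\psi_m\psi^*_n-\langle 0|\psi_m\psi^*_n|0\rangle$ (so $\langle0|\psi_{-n}\psi^*_n|0\rangle=1$ for $n\le 0$ and $0$ otherwise). Define the fermion bilinears $$W_0=\sum_{n\in\mathbb{Z}}n^2:\psi_{-n}\psi^*_n:,\qquad J_k=\sum_{n\in\mathbb{Z}}:\psi_{-n}\psi^*_{n+k}:\ (k\in\mathbb{Z}),\qquad V^{(k)}_m=q^{-km/2}\sum_{n\in\mathbb{Z}}q^{kn}:\psi_{m-n}\psi^*_n:\ (k,m\in\mathbb{Z}).$$ Define the vertex operators $\Gamma_{\pm}(z)=\exp\big(\sum_{k\ge1}\frac{z^k}{k}J_{\pm k}\big)$, $\Gamma'_{\pm}(z)=\exp\big(-\sum_{k\ge1}\frac{(-z)^k}{k}J_{\pm k}\big)$, and $\Gamma_{\pm}(q^{-\rho})=\prod_{i\ge1}\Gamma_{\pm}(q^{i-1/2})$, $\Gamma'_{\pm}(q^{-\rho})=\prod_{i\ge1}\Gamma'_{\pm}(q^{i-1/2})$.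 Here $q^{W_0/2}$ acts by $q^{n^2/2}$ on the eigenvalue-$n^2$ components as determined by $W_0$. *)

theory Defs
  imports "HOL-Analysis.Analysis"
begin

text \<open>Fermionic Fock space. A basis state is a Maya diagram S (a set of integer
 positions, finite symmetric difference with the vacuum {..0}), viewed as the
 semi-infinite wedge of its elements in decreasing order. The mode psi_m creates a
 particle at position -m, psistar_n annihilates a particle at position n.
 Vectors are arbitrary coefficient functions (formal completion); operators act on them.\<close>

type_synonym vec = "int set \<Rightarrow> complex"
type_synonym fop = "vec \<Rightarrow> vec"

definition maya :: "int set \<Rightarrow> bool" where
  "maya S \<longleftrightarrow> finite (S - {..0}) \<and> finite ({..0} - S)"

definition vac :: "int set" where
  "vac = {..0}"

definition basis :: "int set \<Rightarrow> vec" where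
  "basis T = (\<lambda>S. if S = T then 1 else 0)"

definition finvec :: "vec \<Rightarrow> bool" where
  "finvec v \<longleftrightarrow> finite {S. v S \<noteq> 0} \<and> (\<forall>S. v S \<noteq> 0 \<longrightarrow> maya S)"

definition psic :: "int \<Rightarrow> fop" where
  "psic a v = (\<lambda>S. if maya S \<and> a \<in> S
      then (-1) ^ card {s\<in>S. a < s} * v (S - {a}) else 0)"

definition psia :: "int \<Rightarrow> fop" where
  "psia a v = (\<lambda>S. if maya S \<and> a \<notin> S
      then (-1) ^ card {s\<in>S. a < s} * v (insert a S) else 0)"

definition psi :: "int \<Rightarrow> fop" where
  "psi m = psic (- m)"

definition psistar :: "int \<Rightarrow> fop" where
  "psistar n = psia n"

definition vev :: "fop \<Rightarrow> complex" where
  "vev X = X (basis vac) vac"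

definition nbil :: "int \<Rightarrow> int \<Rightarrow> fop" where
  "nbil m n v = (\<lambda>S. psi m (psistar n v) S - vev (\<lambda>w. psi m (psistar n w)) * v S)"

definition J :: "int \<Rightarrow> fop" where
  "J k v = (\<lambda>S. infsum (\<lambda>n. nbil (- n) (n + k) v S) UNIV)"

text \<open>V^(k)_m; q is the parameter, r the fixed square root of q\<close>
definition Vop :: "complex \<Rightarrow> complex \<Rightarrow> int \<Rightarrow> int \<Rightarrow> fop" where
  "Vop q r k m v = (\<lambda>S. r powi (- k * m) *
      infsum (\<lambda>n. q powi (k * n) * nbil (m - n) n v S) UNIV)"

definition W0 :: fop where
  "W0 v = (\<lambda>S. infsum (\<lambda>n. of_int (n ^ 2) * nbil (- n) n v S) UNIV)"

text \<open>q^(e W_0/2) for e = 1 or -1: acts on the eigenvector |S> of W_0 with eigenvalue w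
 by (q^(1/2))^(e w)\<close>
definition qW0half :: "complex \<Rightarrow> int \<Rightarrow> fop" where
  "qW0half r e v = (\<lambda>S. r powi (e * (THE w::int. W0 (basis S) = (\<lambda>T. of_int w * basis S T)))
      * v S)"

definition Jsum :: "int \<Rightarrow> complex \<Rightarrow> fop" where
  "Jsum s z v = (\<lambda>S. suminf (\<lambda>k. z ^ Suc k / of_nat (Suc k) * J (s * int (Suc k)) v S))"

definition op_neg :: "fop \<Rightarrow> fop" where
  "op_neg X v = (\<lambda>S. - X v S)"

definition op_exp :: "fop \<Rightarrow> fop" where
  "op_exp X v = (\<lambda>S. suminf (\<lambda>j. (X ^^ j) v S / fact j))"

definition Gamma_plus :: "complex \<Rightarrow> fop" where
  "Gamma_plus z = op_exp (Jsum 1 z)"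
definition Gamma_minus :: "complex \<Rightarrow> fop" where
  "Gamma_minus z = op_exp (Jsum (-1) z)"
definition Gamma_plus' :: "complex \<Rightarrow> fop" where
  "Gamma_plus' z = op_exp (op_neg (Jsum 1 (- z)))"
definition Gamma_minus' :: "complex \<Rightarrow> fop" where
  "Gamma_minus' z = op_exp (op_neg (Jsum (-1) (- z)))"

text \<open>inverses of the single vertex operators: exp(X)^(-1) = exp(-X)\<close>
definition Gamma_plus_inv :: "complex \<Rightarrow> fop" where
  "Gamma_plus_inv z = op_exp (op_neg (Jsum 1 z))"
definition Gamma_minus_inv :: "complex \<Rightarrow> fop" where
  "Gamma_minus_inv z = op_exp (op_neg (Jsum (-1) z))"
definition Gamma_plus'_inv :: "complex \<Rightarrow> fop" where
  "Gamma_plus'_inv z = op_exp (Jsum 1 (- z))"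
definition Gamma_minus'_inv :: "complex \<Rightarrow> fop" where
  "Gamma_minus'_inv z = op_exp (Jsum (-1) (- z))"

text \<open>partial products G(q^(1/2)) o ... o G(q^(N-1/2)), with q^(i-1/2) = q^(i-1) * r\<close>
fun opprod :: "(complex \<Rightarrow> fop) \<Rightarrow> complex \<Rightarrow> complex \<Rightarrow> nat \<Rightarrow> fop" where
  "opprod G q r 0 = id"
| "opprod G q r (Suc N) = opprod G q r N \<circ> G (q ^ N * r)"

text \<open>G(q^-rho) = prod_{i>=1} G(q^(i-1/2)), as a componentwise limit\<close>
definition at_rho :: "(complex \<Rightarrow> fop) \<Rightarrow> complex \<Rightarrow> complex \<Rightarrow> fop" where
  "at_rho G q r v = (\<lambda>S. lim (\<lambda>N. opprod G q r N v S))"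

end

theory Submission
  imports Defs
begin

text \<open>
  After subtraction of its constant, V^(k)_m satisfies
  [J_l, V^(k)_m] = (r^(kl) - r^(-kl)) V^(k)_(m+l) without a central term, where r^2 = q. Write y for
  the shift V_m to V_(m+1), and c_l = r^l / ((1 - q^l) l) for the coefficient of J_l in the logarithm
  of Gamma_+(q^-rho). Conjugation by Gamma_+(q^-rho) multiplies V_m by
  exp (sum_l c_l (r^(kl) - r^(-kl)) y^l), which is the polynomial prod_(i<k) (1 - r^(2i+1-k) y).
  Conjugation by Gamma_-(q^-rho)^(-1) multiplies by the same polynomial in 1/y. This polynomial is
  palindromic up to the sign (-1)^k, which gives (i); (ii) is the case k < 0 with alternating signs.
  The exponentials are never manipulated as such: their homogeneous components satisfy the recursion
  n H_n = sum_l l c_l J_l H_(n-l), and everything follows from it by induction on n.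
\<close>

subsection \<open>Fermionic bilinears\<close>

text \<open>On the formal completion, \<open>infsum\<close>, \<open>suminf\<close> and
  \<open>lim\<close> carry no information where they diverge, so neither linearity nor a product law
  can be taken for granted. Two finiteness facts replace convergence. A bilinear moves one particle,
  so only finitely many modes of a given degree act on a given diagram. A current of sign s moves
  energy in one direction only, so on vectors bounded in energy on that side each component of its
  exponential is a finite sum. A finite vector is bounded on both sides, but its image is only
  bounded on one; hence the two sides of (i) are evaluated separately, each down to a finite
  combination of modes V applied to v.

  The polynomial arises because r^l (r^(kl) - r^(-kl)) / (1 - q^l) is minus the sum of r^((2i+1-k)l)
  over i < k: the denominator left by the infinite product is exactly that of a geometric sum. The
  exponents 2i+1-k are symmetric about 0, so the roots come in inverse pairs and the powers of r
  multiply to 1. What remains is (-1)^k in (i); in (ii) the alternating signs turn it into 1.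

  Part (iii) needs none of this: the conjugating operator is diagonal.\<close>

definition wedge_sign :: "int \<Rightarrow> int set \<Rightarrow> complex" where
  "wedge_sign a S = (-1) ^ card {s\<in>S. a < s}"

lemma wedge_sign_square [simp]: "wedge_sign a S * wedge_sign a S = 1"
  by (simp add: wedge_sign_def flip: power_add mult_2)

text \<open>Outside a window [-M, M] the diagram agrees with the vacuum. In this form the condition
  cuts infinite mode sums down to finite ones.\<close>

lemma maya_iff_window: "maya S \<longleftrightarrow> (\<exists>M\<ge>0. {..-M} \<subseteq> S \<and> S \<subseteq> {..M})"
proof
  assume "maya S"
  then have "finite ((S - {..0}) \<union> ({..0} - S) \<union> {0})"
    unfolding maya_def by auto
  then have fin: "finite (abs ` ((S - {..0}) \<union> ({..0} - S) \<union> {0}))"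
    by (rule finite_imageI)
  define M where "M = Max (abs ` ((S - {..0}) \<union> ({..0} - S) \<union> {0}))"
  have M: "\<bar>x\<bar> \<le> M" if "x \<in> (S - {..0}) \<union> ({..0} - S) \<union> {0}" for x
    unfolding M_def using fin that by (intro Max_ge) auto
  have "0 \<le> M" using M[of 0] by auto
  moreover have "{..- (M+1)} \<subseteq> S"
  proof
    fix x assume x: "x \<in> {..- (M+1)}"
    show "x \<in> S"
    proof (rule ccontr)
      assume "x \<notin> S"
      then have "\<bar>x\<bar> \<le> M" using x \<open>0 \<le> M\<close> by (intro M) auto
      then show False using x by simp
    qed
  qed
  moreover have "S \<subseteq> {..M+1}"
  proof
    fix x assume x: "x \<in> S"
    show "x \<in> {..M+1}"
    proof (rule ccontr)
      assume "x \<notin> {..M+1}"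
      then show False using M[of x] x \<open>0 \<le> M\<close> by auto
    qed
  qed
  ultimately show "\<exists>M\<ge>0. {..-M} \<subseteq> S \<and> S \<subseteq> {..M}"
    by (intro exI[of _ "M+1"]) auto
next
  assume "\<exists>M\<ge>0. {..-M} \<subseteq> S \<and> S \<subseteq> {..M}"
  then obtain M where M: "{..-M} \<subseteq> S" "S \<subseteq> {..M}" by auto
  have "S - {..0} \<subseteq> {0..M}" "{..0} - S \<subseteq> {-M..0}"
    using M by (auto simp: subset_iff not_le) (metis linorder_le_cases)
  then show "maya S"
    unfolding maya_def by (meson finite_atLeastAtMost_int finite_subset)
qed

lemma maya_insert [simp]: "maya (insert a S) \<longleftrightarrow> maya S"
proof -
  have "insert a S - {..0} = (if a \<le> 0 then S - {..0} else insert a (S - {..0}))" by auto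
  moreover have "finite ({..0} - insert a S) \<longleftrightarrow> finite ({..0} - S)"
    by (metis Diff_insert finite_Diff_insert finite_Diff2 finite.emptyI finite_insert)
  ultimately show ?thesis by (simp add: maya_def)
qed

lemma maya_remove [simp]: "maya (S - {a}) \<longleftrightarrow> maya S"
  by (metis insert_Diff_single maya_insert)

lemma maya_vac [simp]: "maya vac"
  by (simp add: maya_def vac_def)

lemma finite_above: "maya S \<Longrightarrow> finite {s\<in>S. a < s}"
proof -
  assume "maya S"
  then obtain M where "S \<subseteq> {..M}" using maya_iff_window by auto
  then have "{s\<in>S. a < s} \<subseteq> {a..M}" by auto
  then show ?thesis by (rule finite_subset) simp
qed

lemma wedge_sign_insert:
  assumes "maya S" "b \<notin> S"
  shows "wedge_sign a (insert b S) = (if a < b then - wedge_sign a S else wedge_sign a S)"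
proof -
  have "{s \<in> insert b S. a < s} = (if a < b then insert b {s\<in>S. a < s} else {s\<in>S. a < s})"
    by auto
  then show ?thesis using finite_above[OF assms(1)] assms(2) by (simp add: wedge_sign_def)
qed

lemma wedge_sign_remove:
  assumes "maya S" "b \<in> S"
  shows "wedge_sign a (S - {b}) = (if a < b then - wedge_sign a S else wedge_sign a S)"
  using wedge_sign_insert[of "S - {b}" b a] assms by (auto simp: insert_absorb)

lemma psic_wedge_sign: "psic a v S = (if maya S \<and> a \<in> S then wedge_sign a S * v (S - {a}) else 0)"
  by (simp add: psic_def wedge_sign_def)

lemma psia_wedge_sign: "psia a v S = (if maya S \<and> a \<notin> S then wedge_sign a S * v (insert a S) else 0)"
  by (simp add: psia_def wedge_sign_def)

text \<open>A vector is a function on all sets of integers, but the modes return 0 off Maya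
  diagrams. The mixed anticommutator contains the identity, so it holds only for vectors that vanish
  there too.\<close>

definition maya_supp :: "vec \<Rightarrow> bool" where
  "maya_supp v \<longleftrightarrow> (\<forall>S. \<not> maya S \<longrightarrow> v S = 0)"

lemma msuppD: "maya_supp v \<Longrightarrow> \<not> maya S \<Longrightarrow> v S = 0"
  by (simp add: maya_supp_def)

lemma maya_supp_psic [simp]: "maya_supp (psic a v)" and maya_supp_psia [simp]: "maya_supp (psia a v)"
  by (simp_all add: maya_supp_def psic_wedge_sign psia_wedge_sign)

lemma psic_psic: "psic a (psic b v) S = - psic b (psic a v) S"
proof -
  have "S - {a} - {b} = S - {b} - {a}" by auto
  then show ?thesis by (auto simp: psic_wedge_sign wedge_sign_remove)
qed

lemma psia_psia: "psia a (psia b v) S = - psia b (psia a v) S"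
  by (auto simp: psia_wedge_sign wedge_sign_insert insert_commute)

lemma psia_psic:
  assumes "maya_supp v"
  shows "psia b (psic c v) S = of_bool (b = c) * v S - psic c (psia b v) S"
proof (cases "maya S")
  case True
  show ?thesis
  proof (cases "b = c")
    case True
    then show ?thesis using \<open>maya S\<close>
      by (auto simp: psia_wedge_sign psic_wedge_sign wedge_sign_insert wedge_sign_remove insert_absorb)
  next
    case False
    then have "insert b S - {c} = insert b (S - {c})" by auto
    then show ?thesis using \<open>maya S\<close> False
      by (auto simp: psia_wedge_sign psic_wedge_sign wedge_sign_insert wedge_sign_remove)
  qed
qed (simp_all add: psia_wedge_sign psic_wedge_sign msuppD[OF assms])

lemma psic_psia_linear:
  "psic a (psia b (\<lambda>T. x * u T - y * w T)) S
     = x * psic a (psia b u) S - y * psic a (psia b w) S"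
  by (simp add: psic_wedge_sign psia_wedge_sign algebra_simps)

text \<open>These are the relations of matrix units. Moving the inner annihilator past the inner
  creator leaves a term with four modes; the two orders give the same one, since exchanging the
  creators and exchanging the annihilators each cost a sign.\<close>

lemma bilinear_commutator:
  assumes "maya_supp v"
  shows "psic a (psia b (psic c (psia d v))) S - psic c (psia d (psic a (psia b v))) S
    = of_bool (b = c) * psic a (psia d v) S - of_bool (a = d) * psic c (psia b v) S"
proof -
  have *: "psic a (psia b (psic c (psia d v))) S
    = of_bool (b = c) * psic a (psia d v) S - psic a (psic c (psia b (psia d v))) S" for a b c d
  proof -
    have "psia b (psic c (psia d v)) = (\<lambda>T. of_bool (b = c) * psia d v T - psic c (psia b (psia d v)) T)"
      by (rule ext) (simp add: psia_psic)
    then show ?thesis by (simp add: psic_wedge_sign[of a] algebra_simps)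
  qed
  have "psia d (psia b v) = (\<lambda>T. - psia b (psia d v) T)"
    by (rule ext) (rule psia_psia)
  then have "psic a (psic c (psia b (psia d v))) S = psic c (psic a (psia d (psia b v))) S"
    by (simp add: psic_psic[of a c]) (simp add: psic_wedge_sign)
  then show ?thesis
    using *[of a b c d] *[of c d a b] by (auto simp: eq_commute)
qed

text \<open>Indexing by particle positions instead of mode numbers turns the vacuum expectation
  value into the occupation number of the vacuum at a.\<close>

definition normal_bilin :: "int \<Rightarrow> int \<Rightarrow> fop" where
  "normal_bilin a b v S = psic a (psia b v) S - of_bool (a = b \<and> b \<le> 0) * v S"

text \<open>The common shape of the modes J and V: a particle moves from n to n - m with amplitude f
  n, constant for J and geometric for V.\<close>

definition shiftop :: "int \<Rightarrow> (int \<Rightarrow> complex) \<Rightarrow> fop" where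
  "shiftop m f v S = (\<Sum>\<^sub>\<infinity>n. f n * normal_bilin (n - m) n v S)"

lemma psic_psia_explicit:
  "psic a (psia b v) S = (if maya S \<and> a \<in> S \<and> (b \<notin> S \<or> b = a)
     then wedge_sign a S * wedge_sign b (S - {a}) * v (insert b (S - {a})) else 0)"
  by (auto simp: psic_wedge_sign psia_wedge_sign)

lemma psic_psia_same: "psic a (psia a v) S = (if maya S \<and> a \<in> S then v S else 0)"
  by (auto simp: psic_psia_explicit wedge_sign_remove insert_absorb)

lemma normal_bilin_same: "maya S \<Longrightarrow> normal_bilin a a v S = (of_bool (a \<in> S) - of_bool (a \<le> 0)) * v S"
  by (simp add: normal_bilin_def psic_psia_same)

lemma normal_bilin_diff:
  "a \<noteq> b \<Longrightarrow> normal_bilin a b v S = (if maya S \<and> a \<in> S \<and> b \<notin> S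
     then wedge_sign a S * wedge_sign b (S - {a}) * v (insert b (S - {a})) else 0)"
  by (simp add: normal_bilin_def psic_psia_explicit)

lemma nbil_eq_normal_bilin: "nbil m n v S = normal_bilin (- m) n v S"
proof -
  have "vev (\<lambda>w. psi m (psistar n w)) = of_bool (- m = n \<and> n \<le> 0)"
  proof (cases "- m = n")
    case True
    then show ?thesis
      by (simp add: vev_def psi_def psistar_def psic_psia_same basis_def) (simp add: vac_def)
  next
    case False
    then have "- m \<in> vac \<Longrightarrow> insert n (vac - {- m}) \<noteq> vac" by auto
    then show ?thesis using False
      by (auto simp: vev_def psi_def psistar_def psic_psia_explicit basis_def)
  qed
  then show ?thesis by (simp add: nbil_def normal_bilin_def psi_def psistar_def)
qed

text \<open>Constants drop out of commutators, so the right-hand side has bare products. Writing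
  them again as normal-ordered ones is what creates a central term.\<close>

lemma normal_bilin_commutator:
  assumes "maya_supp v"
  shows "normal_bilin a b (normal_bilin c d v) S - normal_bilin c d (normal_bilin a b v) S
    = of_bool (b = c) * psic a (psia d v) S - of_bool (a = d) * psic c (psia b v) S"
proof -
  have *: "normal_bilin a b (normal_bilin c d v) S = psic a (psia b (psic c (psia d v))) S
      - of_bool (c = d \<and> d \<le> 0) * psic a (psia b v) S
      - of_bool (a = b \<and> b \<le> 0) * (psic c (psia d v) S - of_bool (c = d \<and> d \<le> 0) * v S)"
    for a b c d
  proof -
    have "normal_bilin c d v = (\<lambda>T. 1 * psic c (psia d v) T - of_bool (c = d \<and> d \<le> 0) * v T)"
      by (rule ext) (simp add: normal_bilin_def)
    then have "psic a (psia b (normal_bilin c d v)) S = 1 * psic a (psia b (psic c (psia d v))) S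
        - of_bool (c = d \<and> d \<le> 0) * psic a (psia b v) S"
      by (simp only: psic_psia_linear)
    then show ?thesis
      by (simp only: normal_bilin_def[of a b] normal_bilin_def[of c d v S] mult_1)
  qed
  show ?thesis
    unfolding *[of a b c d] *[of c d a b] bilinear_commutator[OF assms, symmetric]
    by (simp only: algebra_simps)
qed

lemma J_eq_shiftop: "J k v S = shiftop k (\<lambda>_. 1) v S"
proof -
  have "J k v S = (\<Sum>\<^sub>\<infinity>n. normal_bilin n (n + k) v S)"
    by (simp add: J_def nbil_eq_normal_bilin)
  also have "\<dots> = (\<Sum>\<^sub>\<infinity>n\<in>(\<lambda>n. n + k) ` UNIV. normal_bilin (n - k) n v S)"
    by (subst infsum_reindex) (simp_all add: o_def)
  finally show ?thesis by (simp add: shiftop_def)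
qed

lemma Vop_eq_shiftop: "Vop q r k m v S = r powi (- k * m) * shiftop m (\<lambda>n. q powi (k * n)) v S"
  by (simp add: Vop_def shiftop_def nbil_eq_normal_bilin)

subsection \<open>Homogeneous operators\<close>

text \<open>The sum of h over S, regularised by subtracting the same sum over the vacuum. Taking h n
  = n gives the energy, h n = n^2 the eigenvalue of \<open>W0\<close>.\<close>

definition weight :: "(int \<Rightarrow> int) \<Rightarrow> int set \<Rightarrow> int" where
  "weight h S = (\<Sum>n\<in>S - {..0}. h n) - (\<Sum>n\<in>{..0} - S. h n)"

lemma weight_insert:
  assumes "maya S" "b \<notin> S"
  shows "weight h (insert b S) = weight h S + h b"
proof -
  have fin: "finite (S - {..0})" "finite ({..0} - S)"
    using assms(1) by (auto simp: maya_def)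
  show ?thesis
  proof (cases "b \<le> 0")
    case True
    then have "insert b S - {..0} = S - {..0}" "{..0} - insert b S = ({..0} - S) - {b}" by auto
    then show ?thesis using True fin assms by (simp add: weight_def sum_diff1)
  next
    case False
    then have "insert b S - {..0} = insert b (S - {..0})" "{..0} - insert b S = {..0} - S" by auto
    then show ?thesis using False fin assms by (simp add: weight_def)
  qed
qed

lemma weight_remove:
  assumes "maya S" "a \<in> S"
  shows "weight h (S - {a}) = weight h S - h a"
  using weight_insert[of "S - {a}" a h] assms by (simp add: insert_absorb)

lemma weight_move:
  assumes "maya S" "a \<in> S" "b \<notin> S"
  shows "weight h (insert b (S - {a})) = weight h S + h b - h a"
  using assms by (simp add: weight_insert weight_remove)

abbreviation energy :: "int set \<Rightarrow> int" where
  "energy \<equiv> weight (\<lambda>n. n)"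

lemma energy_nonneg: "maya S \<Longrightarrow> 0 \<le> energy S"
proof -
  assume "maya S"
  have "0 \<le> (\<Sum>n\<in>S - {..0}. n)" "(\<Sum>n\<in>{..0} - S. n) \<le> 0"
    by (auto intro!: sum_nonneg sum_nonpos)
  then show ?thesis by (simp add: weight_def)
qed

text \<open>All modes used below have finite rows: each component of the image depends on finitely many
  components of the argument, even on the formal completion. This is what makes them linear and
  continuous for componentwise limits.\<close>

definition homog :: "int \<Rightarrow> fop \<Rightarrow> bool" where
  "homog k X \<longleftrightarrow> (\<forall>S. \<exists>F a. finite F \<and> (\<forall>T\<in>F. maya S \<and> maya T \<and> energy T = energy S + k)
     \<and> (\<forall>v. maya_supp v \<longrightarrow> X v S = (\<Sum>T\<in>F. a T * v T)))"

lemma hopE: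
  assumes "homog k X"
  obtains F a where "finite F" "\<forall>T\<in>F. maya S \<and> maya T \<and> energy T = energy S + k"
    "\<forall>v. maya_supp v \<longrightarrow> X v S = (\<Sum>T\<in>F. a T * v T)"
  using assms[unfolded homog_def, THEN spec[of _ S]] by (elim exE conjE)

lemma hopI:
  assumes "\<And>S. \<exists>F a. finite F \<and> (\<forall>T\<in>F. maya S \<and> maya T \<and> energy T = energy S + k)
     \<and> (\<forall>v. maya_supp v \<longrightarrow> X v S = (\<Sum>T\<in>F. a T * v T))"
  shows "homog k X"
  using assms by (simp add: homog_def)

text \<open>Homogeneity is a condition on single rows, so the comparison operator may depend on S.
  This is needed because the window that truncates a mode sum depends on S.\<close>

lemma homog_local:
  assumes "\<And>S. \<exists>Y. homog k Y \<and> (\<forall>v. maya_supp v \<longrightarrow> X v S = Y v S)"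
  shows "homog k X"
proof (rule hopI)
  fix S
  obtain Y where Y: "homog k Y" "\<forall>v. maya_supp v \<longrightarrow> X v S = Y v S"
    using assms[of S] by (elim exE conjE)
  show "\<exists>F a. finite F \<and> (\<forall>T\<in>F. maya S \<and> maya T \<and> energy T = energy S + k)
     \<and> (\<forall>v. maya_supp v \<longrightarrow> X v S = (\<Sum>T\<in>F. a T * v T))"
    using Y(1)[unfolded homog_def, THEN spec[of _ S]] Y(2) by simp
qed

lemma homog_zero: "homog k (\<lambda>v S. 0)"
  by (rule hopI) (rule exI[of _ "{}"], simp)

lemma homog_id: "homog 0 (\<lambda>v. v)"
proof (rule hopI)
  fix S
  show "\<exists>F a. finite F \<and> (\<forall>T\<in>F. maya S \<and> maya T \<and> energy T = energy S + 0)
     \<and> (\<forall>v. maya_supp v \<longrightarrow> v S = (\<Sum>T\<in>F. a T * v T))"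
    by (rule exI[of _ "if maya S then {S} else {}"], rule exI[of _ "\<lambda>_. 1"])
      (auto simp: maya_supp_def)
qed

lemma homog_scale:
  assumes "homog k X"
  shows "homog k (\<lambda>v S. c S * X v S)"
proof (rule hopI)
  fix S
  obtain F a where *: "finite F" "\<forall>T\<in>F. maya S \<and> maya T \<and> energy T = energy S + k"
    "\<forall>v. maya_supp v \<longrightarrow> X v S = (\<Sum>T\<in>F. a T * v T)"
    by (rule hopE[OF assms, of S])
  show "\<exists>F a. finite F \<and> (\<forall>T\<in>F. maya S \<and> maya T \<and> energy T = energy S + k)
     \<and> (\<forall>v. maya_supp v \<longrightarrow> c S * X v S = (\<Sum>T\<in>F. a T * v T))"
    by (rule exI[of _ F], rule exI[of _ "\<lambda>T. c S * a T"])
      (use * in \<open>auto simp: sum_distrib_left mult.assoc\<close>)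
qed

lemma homog_add:
  assumes "homog k X" "homog k Y"
  shows "homog k (\<lambda>v S. X v S + Y v S)"
proof (rule hopI)
  fix S
  obtain F a where F: "finite F" "\<forall>T\<in>F. maya S \<and> maya T \<and> energy T = energy S + k"
    "\<forall>v. maya_supp v \<longrightarrow> X v S = (\<Sum>T\<in>F. a T * v T)"
    by (rule hopE[OF assms(1), of S])
  obtain G b where G: "finite G" "\<forall>T\<in>G. maya S \<and> maya T \<and> energy T = energy S + k"
    "\<forall>v. maya_supp v \<longrightarrow> Y v S = (\<Sum>T\<in>G. b T * v T)"
    by (rule hopE[OF assms(2), of S])
  have "X v S + Y v S = (\<Sum>T\<in>F \<union> G. (of_bool (T \<in> F) * a T + of_bool (T \<in> G) * b T) * v T)"
    if "maya_supp v" for v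
  proof -
    have "(\<Sum>T\<in>F. a T * v T) = (\<Sum>T\<in>F \<union> G. of_bool (T \<in> F) * a T * v T)"
      using F(1) G(1) by (intro sum.mono_neutral_cong_left) auto
    moreover have "(\<Sum>T\<in>G. b T * v T) = (\<Sum>T\<in>F \<union> G. of_bool (T \<in> G) * b T * v T)"
      using F(1) G(1) by (intro sum.mono_neutral_cong_left) auto
    ultimately show ?thesis
      using F(3) G(3) that by (simp add: distrib_right sum.distrib)
  qed
  then show "\<exists>F a. finite F \<and> (\<forall>T\<in>F. maya S \<and> maya T \<and> energy T = energy S + k)
     \<and> (\<forall>v. maya_supp v \<longrightarrow> X v S + Y v S = (\<Sum>T\<in>F. a T * v T))"
    using F(1,2) G(1,2)
    by (intro exI[of _ "F \<union> G"] exI[of _ "\<lambda>T. of_bool (T \<in> F) * a T + of_bool (T \<in> G) * b T"]) auto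
qed

lemma homog_sum:
  assumes "finite I" "\<And>i. i \<in> I \<Longrightarrow> homog k (X i)"
  shows "homog k (\<lambda>v S. \<Sum>i\<in>I. X i v S)"
  using assms by (induction I rule: finite_induct) (simp_all add: homog_zero homog_add)

lemma homog_maya_supp:
  assumes "homog k X" "maya_supp v"
  shows "maya_supp (X v)"
  unfolding maya_supp_def
proof (intro allI impI)
  fix S assume "\<not> maya S"
  obtain F a where F: "finite F" "\<forall>T\<in>F. maya S \<and> maya T \<and> energy T = energy S + k"
    "\<forall>v. maya_supp v \<longrightarrow> X v S = (\<Sum>T\<in>F. a T * v T)"
    by (rule hopE[OF assms(1), of S])
  then have "F = {}" using \<open>\<not> maya S\<close> by auto
  then show "X v S = 0" using F(3) assms(2) by simp
qed

lemma homog_comp: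
  assumes "homog k X" "homog l Y"
  shows "homog (k + l) (\<lambda>v. X (Y v))"
proof (rule hopI)
  fix S
  obtain F a where F: "finite F" "\<forall>T\<in>F. maya S \<and> maya T \<and> energy T = energy S + k"
    "\<forall>v. maya_supp v \<longrightarrow> X v S = (\<Sum>T\<in>F. a T * v T)"
    by (rule hopE[OF assms(1), of S])
  obtain G b where G0: "\<forall>T. finite (G T) \<and> (\<forall>U\<in>G T. maya T \<and> maya U \<and> energy U = energy T + l)
      \<and> (\<forall>v. maya_supp v \<longrightarrow> Y v T = (\<Sum>U\<in>G T. b T U * v U))"
    using assms(2) unfolding homog_def choice_iff by (elim exE)
  then have G: "\<And>T. finite (G T)" "\<And>T U. U \<in> G T \<Longrightarrow> maya U"
    "\<And>T U. U \<in> G T \<Longrightarrow> energy U = energy T + l" "\<And>T v. maya_supp v \<Longrightarrow> Y v T = (\<Sum>U\<in>G T. b T U * v U)"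
    by auto
  define H where "H = (\<Union>T\<in>F. G T)"
  have H: "finite H" using F(1) G(1) by (simp add: H_def)
  have "X (Y v) S = (\<Sum>U\<in>H. (\<Sum>T\<in>F. of_bool (U \<in> G T) * a T * b T U) * v U)" if v: "maya_supp v" for v
  proof -
    have "X (Y v) S = (\<Sum>T\<in>F. a T * Y v T)"
      using F(3) homog_maya_supp[OF assms(2) v] by blast
    also have "\<dots> = (\<Sum>T\<in>F. \<Sum>U\<in>G T. a T * b T U * v U)"
      by (simp add: G(4)[OF v] sum_distrib_left mult.assoc)
    also have "\<dots> = (\<Sum>T\<in>F. \<Sum>U\<in>H. of_bool (U \<in> G T) * a T * b T U * v U)"
      using H by (intro sum.cong refl sum.mono_neutral_cong_left) (auto simp: H_def)
    also have "\<dots> = (\<Sum>U\<in>H. \<Sum>T\<in>F. of_bool (U \<in> G T) * a T * b T U * v U)"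
      by (rule sum.swap)
    finally show ?thesis by (simp add: sum_distrib_right)
  qed
  moreover have "\<forall>U\<in>H. maya S \<and> maya U \<and> energy U = energy S + (k + l)"
    using F G by (auto simp: H_def)
  ultimately show "\<exists>F a. finite F \<and> (\<forall>T\<in>F. maya S \<and> maya T \<and> energy T = energy S + (k + l))
     \<and> (\<forall>v. maya_supp v \<longrightarrow> X (Y v) S = (\<Sum>T\<in>F. a T * v T))"
    using H
    by (intro exI[of _ H] exI[of _ "\<lambda>U. \<Sum>T\<in>F. of_bool (U \<in> G T) * a T * b T U"]) auto
qed

text \<open>The way the grading is exploited: below a homogeneous operator, an infinite object may
  be replaced by any truncation that agrees with it at the one energy that is read.\<close>

lemma homog_cong:
  assumes "homog k X" "maya_supp u" "maya_supp v" "\<And>T. maya S \<Longrightarrow> maya T \<Longrightarrow> energy T = energy S + k \<Longrightarrow> u T = v T"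
  shows "X u S = X v S"
proof -
  obtain F a where F: "finite F" "\<forall>T\<in>F. maya S \<and> maya T \<and> energy T = energy S + k"
    "\<forall>v. maya_supp v \<longrightarrow> X v S = (\<Sum>T\<in>F. a T * v T)"
    by (rule hopE[OF assms(1), of S])
  then show ?thesis using assms by simp
qed

lemma maya_supp_sum: "(\<And>i. i \<in> I \<Longrightarrow> maya_supp (u i)) \<Longrightarrow> maya_supp (\<lambda>T. \<Sum>i\<in>I. c i * u i T)"
  by (auto simp: maya_supp_def intro!: sum.neutral)

lemma homog_linear:
  assumes "homog k X" "\<And>i. i \<in> I \<Longrightarrow> maya_supp (u i)"
  shows "X (\<lambda>T. \<Sum>i\<in>I. c i * u i T) S = (\<Sum>i\<in>I. c i * X (u i) S)"
proof -
  obtain F a where "\<forall>v. maya_supp v \<longrightarrow> X v S = (\<Sum>T\<in>F. a T * v T)"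
    by (rule hopE[OF assms(1), of S])
  then have F: "\<And>v. maya_supp v \<Longrightarrow> X v S = (\<Sum>T\<in>F. a T * v T)" by blast
  have "X (\<lambda>T. \<Sum>i\<in>I. c i * u i T) S = (\<Sum>T\<in>F. \<Sum>i\<in>I. c i * (a T * u i T))"
    using assms(2) by (simp add: F maya_supp_sum sum_distrib_left mult.left_commute)
  also have "\<dots> = (\<Sum>i\<in>I. \<Sum>T\<in>F. c i * (a T * u i T))"
    by (rule sum.swap)
  also have "\<dots> = (\<Sum>i\<in>I. c i * X (u i) S)"
    using assms(2) by (intro sum.cong) (simp_all add: F sum_distrib_left)
  finally show ?thesis .
qed

lemma homog_tendsto:
  assumes "homog k X" "\<And>N. maya_supp (u N)" "maya_supp w" "\<And>T. (\<lambda>N. u N T) \<longlonglongrightarrow> w T"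
  shows "(\<lambda>N. X (u N) S) \<longlonglongrightarrow> X w S"
proof -
  obtain F a where "\<forall>v. maya_supp v \<longrightarrow> X v S = (\<Sum>T\<in>F. a T * v T)"
    by (rule hopE[OF assms(1), of S])
  then have F: "\<And>v. maya_supp v \<Longrightarrow> X v S = (\<Sum>T\<in>F. a T * v T)" by blast
  show ?thesis unfolding F[OF assms(2)] F[OF assms(3)]
    by (intro tendsto_intros assms(4))
qed

section \<open>Window truncation and commutators of shift operators\<close>

lemma normal_bilin_cong:
  assumes "u S = w S" "a \<in> S \<Longrightarrow> b \<notin> S \<Longrightarrow> u (insert b (S - {a})) = w (insert b (S - {a}))"
  shows "normal_bilin a b u S = normal_bilin a b w S"
proof (cases "a = b")
  case True
  then show ?thesis using assms by (simp add: normal_bilin_def psic_psia_same)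
next
  case False
  then show ?thesis using assms by (simp add: normal_bilin_diff)
qed

lemma normal_bilin_linear: "normal_bilin a b (\<lambda>T. \<Sum>i\<in>I. c i * u i T) S = (\<Sum>i\<in>I. c i * normal_bilin a b (u i) S)"
proof (cases "a = b")
  case True
  then show ?thesis
    by (cases "maya S \<and> a \<in> S")
      (auto simp: normal_bilin_def psic_psia_same sum_distrib_left right_diff_distrib sum_subtractf
        mult.left_commute)
next
  case False
  then show ?thesis
    by (cases "maya S \<and> a \<in> S \<and> b \<notin> S")
      (auto simp: normal_bilin_diff sum_distrib_left mult.left_commute)
qed

lemma normal_bilin_not_maya: "maya_supp v \<Longrightarrow> \<not> maya S \<Longrightarrow> normal_bilin a b v S = 0"
  by (simp add: normal_bilin_def psic_wedge_sign msuppD)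

lemma homog_normal_bilin: "homog (b - a) (normal_bilin a b)"
proof (cases "a = b")
  case True
  show ?thesis
  proof (rule homog_local)
    fix S
    have "\<forall>v. maya_supp v \<longrightarrow> normal_bilin a b v S = (of_bool (a \<in> S) - of_bool (a \<le> 0)) * v S"
      using True normal_bilin_same[of S a] normal_bilin_not_maya[of _ S a a] msuppD by (cases "maya S") auto
    moreover have "homog (b - a) (\<lambda>v S. (of_bool (a \<in> S) - of_bool (a \<le> 0)) * v S)"
      using True homog_scale[OF homog_id] by simp
    ultimately show "\<exists>Y. homog (b - a) Y \<and> (\<forall>v. maya_supp v \<longrightarrow> normal_bilin a b v S = Y v S)"
      by blast
  qed
next
  case False
  show ?thesis
  proof (rule hopI)
    fix S
    show "\<exists>F c. finite F \<and> (\<forall>T\<in>F. maya S \<and> maya T \<and> energy T = energy S + (b - a))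
       \<and> (\<forall>v. maya_supp v \<longrightarrow> normal_bilin a b v S = (\<Sum>T\<in>F. c T * v T))"
      by (rule exI[of _ "if maya S \<and> a \<in> S \<and> b \<notin> S then {insert b (S - {a})} else {}"],
          rule exI[of _ "\<lambda>_. wedge_sign a S * wedge_sign b (S - {a})"])
        (auto simp: normal_bilin_diff[OF False] weight_move)
  qed
qed

text \<open>For m \<noteq> 0 a nonzero term needs n - m occupied and n empty, hence n - m \<le> M
  and -M < n, which confines n. For m = 0 the occupation outside the window is that of the vacuum,
  and normal ordering subtracts it.\<close>

lemma normal_bilin_window:
  assumes "{..-M} \<subseteq> S" "S \<subseteq> {..M}" "0 \<le> M" "n \<notin> {-M-\<bar>m\<bar>..M+\<bar>m\<bar>}"
  shows "normal_bilin (n - m) n v S = 0"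
proof (cases "m = 0")
  case True
  have "maya S" using assms maya_iff_window by blast
  moreover have "n \<in> S \<longleftrightarrow> n \<le> 0"
  proof (cases "n \<le> 0")
    case True
    then have "n \<in> {..-M}" using assms(4) \<open>m = 0\<close> \<open>0 \<le> M\<close> by auto
    then show ?thesis using True assms(1) by auto
  next
    case False
    then have "n \<notin> {..M}" using assms(4) \<open>m = 0\<close> \<open>0 \<le> M\<close> by auto
    then show ?thesis using False assms(2) by auto
  qed
  ultimately show ?thesis using True by (simp add: normal_bilin_same)
next
  case False
  have "n \<in> S" if "n - m \<in> S"
  proof -
    have "n - m \<le> M" using that assms(2) by auto
    then have "n \<in> {..-M}" using assms(4) by auto
    then show ?thesis using assms(1) by auto
  qed
  then show ?thesis using False by (auto simp: normal_bilin_diff)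
qed

lemma shiftop_window:
  assumes "{..-M} \<subseteq> S" "S \<subseteq> {..M}" "0 \<le> M" "M + \<bar>m\<bar> \<le> N"
  shows "shiftop m f v S = (\<Sum>n\<in>{-N..N}. f n * normal_bilin (n - m) n v S)"
proof -
  have "normal_bilin (n - m) n v S = 0" if "n \<notin> {-N..N}" for n
    by (rule normal_bilin_window[OF assms(1-3)]) (use assms(4) that in auto)
  then have "shiftop m f v S = (\<Sum>\<^sub>\<infinity>n\<in>{-N..N}. f n * normal_bilin (n - m) n v S)"
    unfolding shiftop_def by (intro infsum_cong_neutral) auto
  then show ?thesis by simp
qed

lemma shiftop_not_maya: "maya_supp v \<Longrightarrow> \<not> maya S \<Longrightarrow> shiftop m f v S = 0"
  by (simp add: shiftop_def normal_bilin_not_maya)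

lemma homog_shiftop: "homog m (shiftop m f)"
proof (rule homog_local)
  fix S
  show "\<exists>Y. homog m Y \<and> (\<forall>v. maya_supp v \<longrightarrow> shiftop m f v S = Y v S)"
  proof (cases "maya S")
    case True
    then obtain M where M: "{..-M} \<subseteq> S" "S \<subseteq> {..M}" "0 \<le> M"
      using maya_iff_window by auto
    have "homog m (normal_bilin (n - m) n)" for n
      using homog_normal_bilin[of n "n - m"] by simp
    then have "homog m (\<lambda>v S. \<Sum>n\<in>{-(M + \<bar>m\<bar>)..M + \<bar>m\<bar>}. f n * normal_bilin (n - m) n v S)"
      by (intro homog_sum homog_scale) simp_all
    then show ?thesis using shiftop_window[OF M order_refl] by blast
  next
    case False
    then show ?thesis using shiftop_not_maya homog_zero by blast
  qed
qed

text \<open>The outer operator replaces S by a diagram that differs by a move of length at most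
  \<bar>l\<bar>, which fits into the window M + \<bar>l\<bar>. One cutoff N then serves both sums,
  so they can be exchanged.\<close>

lemma shiftop_shiftop_window:
  assumes "{..-M} \<subseteq> S" "S \<subseteq> {..M}" "0 \<le> M" "M + \<bar>l\<bar> + \<bar>m\<bar> \<le> N"
  shows "shiftop l g (shiftop m f v) S
    = (\<Sum>i\<in>{-N..N}. \<Sum>j\<in>{-N..N}. g i * f j * normal_bilin (i - l) i (normal_bilin (j - m) j v) S)"
proof -
  have "normal_bilin (i - l) i (shiftop m f v) S
      = normal_bilin (i - l) i (\<lambda>T. \<Sum>j\<in>{-N..N}. f j * normal_bilin (j - m) j v T) S" for i
  proof (rule normal_bilin_cong)
    show "shiftop m f v S = (\<Sum>j\<in>{-N..N}. f j * normal_bilin (j - m) j v S)"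
      by (rule shiftop_window[OF assms(1-3)]) (use assms(4) in auto)
  next
    assume il: "i - l \<in> S" "i \<notin> S"
    let ?S = "insert i (S - {i - l})"
    have "i - l \<le> M" using il assms(2) by auto
    have "- M < i"
    proof (rule ccontr)
      assume "\<not> - M < i"
      then have "i \<in> {..-M}" by simp
      then show False using il assms(1) by auto
    qed
    have "{..-(M + \<bar>l\<bar>)} \<subseteq> ?S"
    proof
      fix x assume "x \<in> {..-(M + \<bar>l\<bar>)}"
      then have "x \<in> {..-M}" "x \<noteq> i - l" using \<open>- M < i\<close> by auto
      then show "x \<in> ?S" using assms(1) by auto
    qed
    moreover have "?S \<subseteq> {..M + \<bar>l\<bar>}" using assms(2) \<open>i - l \<le> M\<close> by auto
    ultimately show "shiftop m f v ?S = (\<Sum>j\<in>{-N..N}. f j * normal_bilin (j - m) j v ?S)"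
      by (rule shiftop_window) (use assms(3,4) in auto)
  qed
  then show ?thesis
    using assms
    by (subst shiftop_window[OF assms(1-3), of l N])
      (auto simp: normal_bilin_linear sum_distrib_left mult.assoc)
qed

lemma sum_telescope_int:
  fixes F :: "int \<Rightarrow> 'a::ab_group_add"
  assumes "a \<le> b + 1"
  shows "(\<Sum>n\<in>{a..b}. F n - F (n - 1)) = F b - F (a - 1)"
  using assms
proof (induction "nat (b + 1 - a)" arbitrary: b)
  case 0
  then have "a = b + 1" by simp
  then show ?case by simp
next
  case (Suc n)
  then have "{a..b} = insert b {a..b - 1}" by auto
  moreover have "(\<Sum>n\<in>{a..b - 1}. F n - F (n - 1)) = F (b - 1) - F (a - 1)"
    using Suc by (intro Suc(1)) auto
  ultimately show ?case by simp
qed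

text \<open>A discrete primitive F of f turns the central term, a finite sum of values of f, into a
  difference whatever the sign of l. The double sums are cut to a window of positions so large that
  all discarded terms vanish on S and on its neighbours.\<close>

lemma shiftop_commutator:
  assumes v: "maya_supp v" and f: "\<And>n. f n = F n - F (n - 1)"
  shows "shiftop l (\<lambda>_. 1) (shiftop m f v) S - shiftop m f (shiftop l (\<lambda>_. 1) v) S
    = shiftop (l + m) (\<lambda>n. f n - f (n - l)) v S + of_bool (l + m = 0) * (F 0 - F (- l)) * v S"
proof (cases "maya S")
  case True
  then obtain M where M: "{..-M} \<subseteq> S" "S \<subseteq> {..M}" "0 \<le> M"
    using maya_iff_window by auto
  \<comment> \<open>One copy of \<bar>l\<bar> + \<bar>m\<bar> pays for the nested operators. The
    other keeps n - m and n - l inside W whenever the bilinear at n does not vanish, so the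
    truncation indicators can be removed.\<close>
  define N where "N = M + 2 * \<bar>l\<bar> + 2 * \<bar>m\<bar>"
  define W where "W = {-N..N}"
  define B where "B n = normal_bilin (n - (l + m)) n v S" for n
  have finW: "finite W" by (simp add: W_def)
  have E: "psic (n - l - m) (psia n v) S = B n + of_bool (l + m = 0 \<and> n \<le> 0) * v S" for n
    by (simp add: B_def normal_bilin_def diff_diff_eq)
  have E': "psic (n - m - l) (psia n v) S = B n + of_bool (l + m = 0 \<and> n \<le> 0) * v S" for n
    using E[of n] by (simp add: algebra_simps)
  have B0: "B n = 0" if "n \<notin> {-M-\<bar>l+m\<bar>..M+\<bar>l+m\<bar>}" for n
    unfolding B_def by (rule normal_bilin_window[OF M that])
  have inner: "(\<Sum>i\<in>W. \<Sum>j\<in>W. of_bool (i = h j) * g j) = (\<Sum>j\<in>W. of_bool (h j \<in> W) * g j)"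
    for g :: "int \<Rightarrow> complex" and h
  proof -
    have "(\<Sum>i\<in>W. \<Sum>j\<in>W. of_bool (i = h j) * g j) = (\<Sum>j\<in>W. \<Sum>i\<in>W. of_bool (i = h j) * g j)"
      by (rule sum.swap)
    also have "\<dots> = (\<Sum>j\<in>W. of_bool (h j \<in> W) * g j)"
      by (intro sum.cong refl) (simp add: finW of_bool_def if_distrib[of "\<lambda>x. x * _"] cong: if_cong)
    finally show ?thesis .
  qed
  have "shiftop l (\<lambda>_. 1) (shiftop m f v) S - shiftop m f (shiftop l (\<lambda>_. 1) v) S
    = (\<Sum>i\<in>W. \<Sum>j\<in>W. f j * normal_bilin (i - l) i (normal_bilin (j - m) j v) S)
      - (\<Sum>j\<in>W. \<Sum>i\<in>W. f j * normal_bilin (j - m) j (normal_bilin (i - l) i v) S)"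
    unfolding W_def
    by (subst (1 2) shiftop_shiftop_window[OF M, where N = N]) (simp_all add: N_def M(3))
  also have "(\<Sum>j\<in>W. \<Sum>i\<in>W. f j * normal_bilin (j - m) j (normal_bilin (i - l) i v) S)
      = (\<Sum>i\<in>W. \<Sum>j\<in>W. f j * normal_bilin (j - m) j (normal_bilin (i - l) i v) S)"
    by (rule sum.swap)
  also have "(\<Sum>i\<in>W. \<Sum>j\<in>W. f j * normal_bilin (i - l) i (normal_bilin (j - m) j v) S) - \<dots>
      = (\<Sum>i\<in>W. \<Sum>j\<in>W. f j * (of_bool (i = j - m) * psic (i - l) (psia j v) S
          - of_bool (i - l = j) * psic (j - m) (psia i v) S))"
    by (simp only: sum_subtractf[symmetric] right_diff_distrib[symmetric] normal_bilin_commutator[OF v])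
  also have "\<dots> = (\<Sum>i\<in>W. \<Sum>j\<in>W. of_bool (i = j - m) * (f j * psic (j - m - l) (psia j v) S))
      - (\<Sum>j\<in>W. \<Sum>i\<in>W. of_bool (j = i - l) * (f (i - l) * psic (i - l - m) (psia i v) S))"
    unfolding right_diff_distrib sum_subtractf
  proof (rule arg_cong2[where f = minus])
    show "(\<Sum>i\<in>W. \<Sum>j\<in>W. f j * (of_bool (i = j - m) * psic (i - l) (psia j v) S))
        = (\<Sum>i\<in>W. \<Sum>j\<in>W. of_bool (i = j - m) * (f j * psic (j - m - l) (psia j v) S))"
      by (intro sum.cong refl) (auto simp: of_bool_def)
    have "(\<Sum>i\<in>W. \<Sum>j\<in>W. f j * (of_bool (i - l = j) * psic (j - m) (psia i v) S))
        = (\<Sum>i\<in>W. \<Sum>j\<in>W. of_bool (j = i - l) * (f (i - l) * psic (i - l - m) (psia i v) S))"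
      by (intro sum.cong refl) (auto simp: of_bool_def)
    also have "\<dots> = (\<Sum>j\<in>W. \<Sum>i\<in>W. of_bool (j = i - l) * (f (i - l) * psic (i - l - m) (psia i v) S))"
      by (rule sum.swap)
    finally show "(\<Sum>i\<in>W. \<Sum>j\<in>W. f j * (of_bool (i - l = j) * psic (j - m) (psia i v) S)) = \<dots>" .
  qed
  also have "\<dots> = (\<Sum>n\<in>W. of_bool (n - m \<in> W) * f n * B n)
      - (\<Sum>n\<in>W. of_bool (n - l \<in> W) * f (n - l) * B n)
      + (\<Sum>n\<in>W. of_bool (n - m \<in> W) * f n * of_bool (l + m = 0 \<and> n \<le> 0) * v S)
      - (\<Sum>n\<in>W. of_bool (n - l \<in> W) * f (n - l) * of_bool (l + m = 0 \<and> n \<le> 0) * v S)"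
    unfolding inner E E' by (simp add: distrib_left sum.distrib mult.assoc)
  also have "(\<Sum>n\<in>W. of_bool (n - m \<in> W) * f n * B n) = (\<Sum>n\<in>W. f n * B n)"
  proof (intro sum.cong refl)
    fix n assume "n \<in> W"
    show "of_bool (n - m \<in> W) * f n * B n = f n * B n"
      by (cases "n \<in> {-M-\<bar>l+m\<bar>..M+\<bar>l+m\<bar>}") (use B0[of n] in \<open>auto simp: W_def N_def\<close>)
  qed
  also have "(\<Sum>n\<in>W. of_bool (n - l \<in> W) * f (n - l) * B n) = (\<Sum>n\<in>W. f (n - l) * B n)"
  proof (intro sum.cong refl)
    fix n assume "n \<in> W"
    show "of_bool (n - l \<in> W) * f (n - l) * B n = f (n - l) * B n"
      by (cases "n \<in> {-M-\<bar>l+m\<bar>..M+\<bar>l+m\<bar>}") (use B0[of n] in \<open>auto simp: W_def N_def\<close>)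
  qed
  also have "(\<Sum>n\<in>W. f n * B n) - (\<Sum>n\<in>W. f (n - l) * B n)
      = shiftop (l + m) (\<lambda>n. f n - f (n - l)) v S"
    unfolding W_def B_def
    by (subst shiftop_window[OF M, where N = N])
      (auto simp: N_def M(3) left_diff_distrib sum_subtractf)
  also have "shiftop (l + m) (\<lambda>n. f n - f (n - l)) v S
      + (\<Sum>n\<in>W. of_bool (n - m \<in> W) * f n * of_bool (l + m = 0 \<and> n \<le> 0) * v S)
      - (\<Sum>n\<in>W. of_bool (n - l \<in> W) * f (n - l) * of_bool (l + m = 0 \<and> n \<le> 0) * v S)
    = shiftop (l + m) (\<lambda>n. f n - f (n - l)) v S + of_bool (l + m = 0) * (F 0 - F (- l)) * v S"
  proof (cases "l + m = 0")
    case True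
    then have m: "m = - l" by simp
    \<comment> \<open>With m = - l, the first sum requires n and n + l to lie in W, so it starts at
      c; the second is the same range translated by l. Both telescopes therefore end in F (c - 1),
      and the dependence on the cutoff cancels.\<close>
    define c where "c = max (-N) (-N-l)"
    have cs: "c \<le> 0" "c + l \<le> 1" using M(3) by (auto simp: c_def N_def)
    have "(\<Sum>n\<in>W. of_bool (n - m \<in> W) * f n * of_bool (l + m = 0 \<and> n \<le> 0))
        = (\<Sum>n\<in>{c..0}. F n - F (n - 1))"
      using M(3) by (intro sum.mono_neutral_cong_right finW)
        (auto simp: W_def c_def N_def m f[symmetric])
    moreover have "(\<Sum>n\<in>W. of_bool (n - l \<in> W) * f (n - l) * of_bool (l + m = 0 \<and> n \<le> 0))
        = (\<Sum>n\<in>{c + l..0}. F (n - l) - F (n - 1 - l))"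
      using M(3) by (intro sum.mono_neutral_cong_right finW)
        (auto simp: W_def c_def N_def m f algebra_simps)
    ultimately have "(\<Sum>n\<in>W. of_bool (n - m \<in> W) * f n * of_bool (l + m = 0 \<and> n \<le> 0)) = F 0 - F (c - 1)"
      "(\<Sum>n\<in>W. of_bool (n - l \<in> W) * f (n - l) * of_bool (l + m = 0 \<and> n \<le> 0)) = F (- l) - F (c - 1)"
      using cs sum_telescope_int[of c 0 F] sum_telescope_int[of "c + l" 0 "\<lambda>n. F (n - l)"]
      by (simp_all add: algebra_simps)
    then show ?thesis
      using True by (simp only: sum_distrib_right[symmetric]) (simp add: algebra_simps)
  qed simp
  finally show ?thesis .
next
  case False
  then show ?thesis
    using v by (simp add: shiftop_not_maya homog_maya_supp[OF homog_shiftop] msuppD)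
qed

subsection \<open>Exponentials of currents\<close>

lemma homog_J: "homog m (J m)"
proof (rule homog_local)
  fix S
  show "\<exists>Y. homog m Y \<and> (\<forall>v. maya_supp v \<longrightarrow> J m v S = Y v S)"
    using homog_shiftop[of m "\<lambda>_. 1"] J_eq_shiftop[of m] by blast
qed

lemma J_eq: "J k = shiftop k (\<lambda>_. 1)"
  by (intro ext) (rule J_eq_shiftop)

text \<open>The central term lives at opposite indices, and two natural multiples of the same
  nonzero s are opposite only if both are 0. The primitive of the constant amplitude 1 is
  \<open>of_int\<close>.\<close>

lemma J_commute:
  assumes "maya_supp v" "s \<noteq> 0"
  shows "J (s * int l) (J (s * int m) v) S = J (s * int m) (J (s * int l) v) S"
proof -
  have "s * int l + s * int m = 0 \<Longrightarrow> l = 0"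
    using assms(2) by (simp add: distrib_left[symmetric])
  then have "of_bool (s * int l + s * int m = 0) * (of_int 0 - of_int (- (s * int l))) * v S = 0"
    by (cases "l = 0") auto
  moreover have "shiftop k (\<lambda>n. 1 - 1) v S = 0" for k
    by (simp add: shiftop_def)
  ultimately show ?thesis
    using shiftop_commutator[OF assms(1), of "\<lambda>_. 1" of_int "s * int l" "s * int m" S]
    by (simp only: J_eq add_0 of_int_diff diff_diff_eq2) simp
qed

lemma sum_triangle_swap:
  fixes g :: "nat \<Rightarrow> nat \<Rightarrow> 'a::comm_monoid_add"
  shows "(\<Sum>i\<le>n. \<Sum>j\<le>n - i. g i j) = (\<Sum>j\<le>n. \<Sum>i\<le>n - j. g i j)"
proof -
  have *: "{..n - i} = {j\<in>{..n}. i + j \<le> n}" if "i \<in> {..n}" for i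
    using that by auto
  have **: "{..n - i} = {j\<in>{..n}. j + i \<le> n}" if "i \<in> {..n}" for i
    using that by auto
  have "(\<Sum>i\<le>n. \<Sum>j\<le>n - i. g i j) = (\<Sum>i\<le>n. \<Sum>j\<in>{j\<in>{..n}. i + j \<le> n}. g i j)"
    by (intro sum.cong refl *)
  also have "\<dots> = (\<Sum>j\<le>n. \<Sum>i\<in>{i\<in>{..n}. i + j \<le> n}. g i j)"
    by (rule sum.swap_restrict) simp_all
  also have "\<dots> = (\<Sum>j\<le>n. \<Sum>i\<le>n - j. g i j)"
    by (intro sum.cong refl **[symmetric])
  finally show ?thesis .
qed

lemma sum_triangle_diagonal:
  fixes g :: "nat \<Rightarrow> nat \<Rightarrow> 'a::comm_monoid_add"
  shows "(\<Sum>i\<le>n. \<Sum>j\<le>n - i. g i j) = (\<Sum>k\<le>n. \<Sum>i\<le>k. g i (k - i))"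
proof -
  have "(\<Sum>k\<le>n. \<Sum>i\<le>k. g i (k - i)) = (\<Sum>k\<le>n. \<Sum>i\<in>{i\<in>{..n}. i \<le> k}. g i (k - i))"
    by (intro sum.cong refl) auto
  also have "\<dots> = (\<Sum>i\<le>n. \<Sum>k\<in>{k\<in>{..n}. i \<le> k}. g i (k - i))"
    by (rule sum.swap_restrict) simp_all
  also have "\<dots> = (\<Sum>i\<le>n. \<Sum>j\<le>n - i. g i j)"
    by (intro sum.cong refl sum.reindex_bij_witness[where i = "\<lambda>j. j + i" and j = "\<lambda>k. k - i" for i])
      auto
  finally show ?thesis by simp
qed

lemma homog_zero_vec: "homog k X \<Longrightarrow> X (\<lambda>_. 0) S = 0"
  using homog_linear[of k X "{}"] by simp

lemma homog_smult: "homog k X \<Longrightarrow> maya_supp u \<Longrightarrow> X (\<lambda>T. c * u T) S = c * X u S"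
  using homog_linear[of k X "{()}" "\<lambda>_. u" "\<lambda>_. c"] by simp

text \<open>The sign s = 1 is used for Gamma_+ on finite vectors, and s = -1 for Gamma_- on arbitrary
  vectors, for which E = 0 always works because energies are nonnegative.\<close>

definition bounded_deg :: "int \<Rightarrow> int \<Rightarrow> vec \<Rightarrow> bool" where
  "bounded_deg s E v \<longleftrightarrow> (\<forall>S. v S \<noteq> 0 \<longrightarrow> maya S \<and> s * energy S \<le> E)"

lemma bounded_deg_maya_supp: "bounded_deg s E v \<Longrightarrow> maya_supp v"
  by (auto simp: bounded_deg_def maya_supp_def)

lemma bdegD: "bounded_deg s E v \<Longrightarrow> E < s * energy S \<Longrightarrow> v S = 0"
  by (force simp: bounded_deg_def)

lemma homog_bounded_deg:
  assumes "homog k X" "bounded_deg s E v" 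
  shows "bounded_deg s (E - s * k) (X v)"
  unfolding bounded_deg_def
proof (intro allI impI)
  fix S assume nz: "X v S \<noteq> 0"
  have "X v S = X (\<lambda>_. 0) S" if "E - s * k < s * energy S"
  proof (rule homog_cong[OF assms(1) bounded_deg_maya_supp[OF assms(2)]])
    fix T assume "energy T = energy S + k"
    then show "v T = 0" using that bdegD[OF assms(2), of T] by (simp add: distrib_left)
  qed (simp add: maya_supp_def)
  then show "maya S \<and> s * energy S \<le> E - s * k"
    using nz homog_zero_vec[OF assms(1)] msuppD[OF homog_maya_supp[OF assms(1) bounded_deg_maya_supp[OF assms(2)]]]
    by (metis linorder_not_le)
qed

text \<open>\<open>pow_part s c j n\<close> and \<open>exp_part s c n\<close> are the components of degree n of X^j
  and exp X, for X the sum of c l J(s l) over l > 0. The index l = 0 is admitted in the sums, always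
  with c 0 = 0; for the coefficients z^l / l this is the convention x / 0 = 0.\<close>

primrec pow_part :: "int \<Rightarrow> (nat \<Rightarrow> complex) \<Rightarrow> nat \<Rightarrow> nat \<Rightarrow> fop" where
  "pow_part s c 0 = (\<lambda>n v S. of_bool (n = 0) * v S)"
| "pow_part s c (Suc j) = (\<lambda>n v S. \<Sum>l\<le>n. c l * J (s * int l) (pow_part s c j (n - l) v) S)"

definition exp_part :: "int \<Rightarrow> (nat \<Rightarrow> complex) \<Rightarrow> nat \<Rightarrow> fop" where
  "exp_part s c n v S = (\<Sum>j\<le>n. pow_part s c j n v S / fact j)"

lemma homog_pow_part: "homog (s * int n) (pow_part s c j n)"
proof (induction j arbitrary: n)
  case 0
  show ?case using homog_id homog_zero by (cases "n = 0") simp_all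
next
  case (Suc j)
  show ?case unfolding pow_part.simps
  proof (intro homog_sum homog_scale)
    fix l assume "l \<in> {..n}"
    then have "s * int n = s * int l + s * int (n - l)"
      by (simp add: of_nat_diff algebra_simps)
    then show "homog (s * int n) (\<lambda>v. J (s * int l) (pow_part s c j (n - l) v))"
      using homog_comp[OF homog_J Suc] by metis
  qed simp
qed

lemma homog_exp_part: "homog (s * int n) (exp_part s c n)"
proof -
  have "exp_part s c n = (\<lambda>v S. \<Sum>j\<le>n. (1 / fact j) * pow_part s c j n v S)"
    by (intro ext) (simp add: exp_part_def)
  then show ?thesis by (simp only:) (intro homog_sum homog_scale homog_pow_part finite_atMost)
qed

text \<open>With c 0 = 0 every factor of X^j has degree at least 1. Hence the finite sum in
  \<open>exp_part\<close> is the whole component of degree n.\<close>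

lemma pow_part_eq_0: "c 0 = 0 \<Longrightarrow> n < j \<Longrightarrow> pow_part s c j n v S = 0"
proof (induction j arbitrary: n S)
  case (Suc j)
  have "c l * J (s * int l) (pow_part s c j (n - l) v) S = 0" if "l \<le> n" for l
  proof (cases l)
    case 0
    then show ?thesis using Suc.prems by simp
  next
    case (Suc l')
    then have "pow_part s c j (n - l) v = (\<lambda>_. 0)"
      using Suc.IH Suc.prems that by (intro ext) auto
    then show ?thesis by (simp add: homog_zero_vec[OF homog_J])
  qed
  then show ?case by (simp add: sum.neutral)
qed simp

lemma exp_part_ge:
  assumes "c 0 = 0" "n \<le> M"
  shows "exp_part s c n v S = (\<Sum>j\<le>M. pow_part s c j n v S / fact j)"
  unfolding exp_part_def using assms
  by (intro sum.mono_neutral_left) (auto simp: pow_part_eq_0)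

lemma exp_part_0 [simp]: "exp_part s c 0 v S = v S"
  by (simp add: exp_part_def)

text \<open>Multiplication by the degree is a derivation D, and the currents commute, so D X^(j+1) =
  (j+1) (D X) X^j.\<close>

lemma pow_part_derivation:
  assumes "s \<noteq> 0" "maya_supp v"
  shows "of_nat n * pow_part s c (Suc j) n v S
    = of_nat (Suc j) * (\<Sum>l\<le>n. of_nat l * c l * J (s * int l) (pow_part s c j (n - l) v) S)"
proof (induction j arbitrary: n S)
  case 0
  have "of_nat n * (c l * J (s * int l) (pow_part s c 0 (n - l) v) S)
      = of_nat l * c l * J (s * int l) (pow_part s c 0 (n - l) v) S" if "l \<le> n" for l
    using that by (cases "l = n") (simp_all add: homog_zero_vec[OF homog_J])
  then have "(\<Sum>l\<le>n. of_nat n * (c l * J (s * int l) (pow_part s c 0 (n - l) v) S))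
      = (\<Sum>l\<le>n. of_nat l * c l * J (s * int l) (pow_part s c 0 (n - l) v) S)"
    by (intro sum.cong refl) simp
  then show ?case
    by (simp only: pow_part.simps(2) sum_distrib_left[symmetric]) simp
next
  case (Suc j)
  have ms: "maya_supp (pow_part s c j n v)" for j n
    by (rule homog_maya_supp[OF homog_pow_part assms(2)])
  \<comment> \<open>The degree n is split as l, carried by the outermost current, plus n - l,
    carried by the remaining factors. The induction hypothesis handles the second share, and
    commuting the currents brings the differentiated one to the front.\<close>
  have split: "of_nat n * (c l * J (s * int l) (pow_part s c (Suc j) (n - l) v) S)
      = of_nat l * c l * J (s * int l) (pow_part s c (Suc j) (n - l) v) S
        + (\<Sum>i\<le>n - l. c l * of_nat (Suc j) * of_nat i * c i *
             J (s * int i) (J (s * int l) (pow_part s c j (n - l - i) v)) S)" if "l \<le> n" for l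
  proof -
    have "of_nat (n - l) * J (s * int l) (pow_part s c (Suc j) (n - l) v) S
        = J (s * int l) (\<lambda>T. of_nat (n - l) * pow_part s c (Suc j) (n - l) v T) S"
      by (rule homog_smult[OF homog_J ms, symmetric])
    also have "\<dots> = J (s * int l) (\<lambda>T. \<Sum>i\<le>n - l. (of_nat (Suc j) * of_nat i * c i) *
        J (s * int i) (pow_part s c j (n - l - i) v) T) S"
      by (simp only: Suc.IH sum_distrib_left mult.assoc)
    also have "\<dots> = (\<Sum>i\<le>n - l. (of_nat (Suc j) * of_nat i * c i) *
        J (s * int l) (J (s * int i) (pow_part s c j (n - l - i) v)) S)"
      by (rule homog_linear[OF homog_J]) (rule homog_maya_supp[OF homog_J ms])
    also have "\<dots> = (\<Sum>i\<le>n - l. (of_nat (Suc j) * of_nat i * c i) *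
        J (s * int i) (J (s * int l) (pow_part s c j (n - l - i) v)) S)"
      by (simp only: J_commute[OF ms assms(1)])
    finally have "c l * (of_nat (n - l) * J (s * int l) (pow_part s c (Suc j) (n - l) v) S)
      = (\<Sum>i\<le>n - l. c l * of_nat (Suc j) * of_nat i * c i *
             J (s * int i) (J (s * int l) (pow_part s c j (n - l - i) v)) S)"
      by (simp only: sum_distrib_left mult.assoc)
    moreover have "(of_nat n :: complex) = of_nat l + of_nat (n - l)"
      using that by (simp add: of_nat_diff)
    moreover have "(a + b) * (x * y) = a * x * y + x * (b * y)" for a b x y :: complex
      by (simp add: algebra_simps)
    ultimately show ?thesis by (simp only:)
  qed
  have "(\<Sum>l\<le>n. \<Sum>i\<le>n - l. c l * of_nat (Suc j) * of_nat i * c i *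
             J (s * int i) (J (s * int l) (pow_part s c j (n - l - i) v)) S)
      = (\<Sum>i\<le>n. \<Sum>l\<le>n - i. c l * of_nat (Suc j) * of_nat i * c i *
             J (s * int i) (J (s * int l) (pow_part s c j (n - l - i) v)) S)"
    by (rule sum_triangle_swap)
  also have "\<dots> = (\<Sum>i\<le>n. of_nat (Suc j) * of_nat i * c i *
      (\<Sum>l\<le>n - i. c l * J (s * int i) (J (s * int l) (pow_part s c j (n - i - l) v)) S))"
    by (simp only: sum_distrib_left diff_diff_eq add.commute mult.assoc mult.left_commute)
  also have "\<dots> = (\<Sum>i\<le>n. of_nat (Suc j) * of_nat i * c i *
      J (s * int i) (pow_part s c (Suc j) (n - i) v) S)"
    unfolding pow_part.simps
    by (subst homog_linear[OF homog_J]) (simp_all add: homog_maya_supp[OF homog_J ms])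
  finally have "of_nat n * pow_part s c (Suc (Suc j)) n v S
      = (\<Sum>l\<le>n. of_nat l * c l * J (s * int l) (pow_part s c (Suc j) (n - l) v) S)
        + of_nat (Suc j) * (\<Sum>i\<le>n. of_nat i * c i * J (s * int i) (pow_part s c (Suc j) (n - i) v) S)"
    unfolding pow_part.simps(2)[of s c "Suc j"]
    by (simp add: sum_distrib_left[of "of_nat n"] split sum.distrib del: pow_part.simps of_nat_Suc
        cong: sum.cong_simp) (simp only: sum_distrib_left mult.assoc)
  then show ?case by (simp add: distrib_right del: pow_part.simps)
qed

text \<open>The degree derivation turns exp X into (D X) exp X. The term l = 0 carries the factor 0,
  so for n > 0 the component of degree n is determined by lower ones.\<close>

lemma exp_part_newton:
  assumes "s \<noteq> 0" "maya_supp v" "c 0 = 0"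
  shows "of_nat n * exp_part s c n v S
    = (\<Sum>l\<le>n. of_nat l * c l * J (s * int l) (exp_part s c (n - l) v) S)"
proof (cases n)
  case (Suc m)
  have "of_nat n * exp_part s c n v S = (\<Sum>j\<le>Suc m. of_nat n * pow_part s c j n v S / fact j)"
    by (simp only: exp_part_def Suc sum_distrib_left times_divide_eq_right)
  also have "\<dots> = (\<Sum>j\<le>m. of_nat n * pow_part s c (Suc j) n v S / fact (Suc j))"
    by (subst sum.atMost_Suc_shift) (simp add: Suc del: pow_part.simps(2))
  also have "\<dots> = (\<Sum>j\<le>m. \<Sum>l\<le>n. of_nat l * c l * (1 / fact j * J (s * int l) (pow_part s c j (n - l) v) S))"
  proof (intro sum.cong refl)
    fix j
    have *: "of_nat (Suc j) * x / fact (Suc j) = 1 / fact j * x" for x :: complex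
      by (simp add: fact_Suc del: of_nat_Suc)
    show "of_nat n * pow_part s c (Suc j) n v S / fact (Suc j)
      = (\<Sum>l\<le>n. of_nat l * c l * (1 / fact j * J (s * int l) (pow_part s c j (n - l) v) S))"
      by (simp only: pow_part_derivation[OF assms(1,2)] *)
        (simp only: sum_distrib_left mult.assoc mult.left_commute)
  qed
  also have "\<dots> = (\<Sum>l\<le>n. \<Sum>j\<le>m. of_nat l * c l * (1 / fact j * J (s * int l) (pow_part s c j (n - l) v) S))"
    by (rule sum.swap)
  also have "\<dots> = (\<Sum>l\<le>n. of_nat l * c l * J (s * int l) (exp_part s c (n - l) v) S)"
  proof (intro sum.cong refl)
    fix l assume "l \<in> {..n}"
    show "(\<Sum>j\<le>m. of_nat l * c l * (1 / fact j * J (s * int l) (pow_part s c j (n - l) v) S))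
      = of_nat l * c l * J (s * int l) (exp_part s c (n - l) v) S"
    proof (cases "l = 0")
      case False
      then have "n - l \<le> m" using Suc by simp
      then have "exp_part s c (n - l) v = (\<lambda>T. \<Sum>j\<le>m. 1 / fact j * pow_part s c j (n - l) v T)"
        using exp_part_ge[where c = c, OF assms(3)] by (intro ext) simp
      then have "J (s * int l) (exp_part s c (n - l) v) S
        = (\<Sum>j\<le>m. 1 / fact j * J (s * int l) (pow_part s c j (n - l) v) S)"
        by (simp only: homog_linear[OF homog_J homog_maya_supp[OF homog_pow_part assms(2)]])
      then show ?thesis by (simp only: sum_distrib_left)
    qed simp
  qed
  finally show ?thesis .
qed simp

text \<open>The hypothesis on e says that its generating function is exp (sum_l c_l a_l t^l).\<close>

lemma exp_part_intertwine:
  assumes s: "s \<noteq> 0" and v: "maya_supp v" and c0: "c 0 = 0" and e0: "e 0 = 1"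
    and W: "\<And>j. homog (p + s * int j) (W j)"
    and comm: "\<And>l j u S. maya_supp u \<Longrightarrow>
      J (s * int l) (W j u) S = W j (J (s * int l) u) S + a l * W (j + l) u S"
    and e: "\<And>n. of_nat n * e n = (\<Sum>l\<le>n. of_nat l * c l * a l * e (n - l))"
  shows "exp_part s c n (W 0 v) S = (\<Sum>j\<le>n. e j * W j (exp_part s c (n - j) v) S)"
proof (induction n arbitrary: S rule: less_induct)
  case (less n)
  have msh: "maya_supp (exp_part s c m v)" for m by (rule homog_maya_supp[OF homog_exp_part v])
  show ?case
  proof (cases "n = 0")
    case True
    have "exp_part s c 0 v = v" by (rule ext) simp
    then show ?thesis by (simp add: True e0)
  next
    case False
    have IH: "of_nat l * c l * J (s * int l) (exp_part s c (n - l) (W 0 v)) S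
      = (\<Sum>j\<le>n - l. e j * of_nat l * c l * W j (J (s * int l) (exp_part s c (n - j - l) v)) S)
      + (\<Sum>j\<le>n - l. of_nat l * c l * a l * e j * W (j + l) (exp_part s c (n - (l + j)) v) S)"
      if "l \<le> n" for l
    \<comment> \<open>The induction hypothesis covers n - l < n only; at l = 0 the factor
      \<open>of_nat l\<close> removes the term.\<close>
    proof (cases "l = 0")
      case False
      have "J (s * int l) (exp_part s c (n - l) (W 0 v)) S
        = J (s * int l) (\<lambda>T. \<Sum>j\<le>n - l. e j * W j (exp_part s c (n - l - j) v) T) S"
      proof -
        have "exp_part s c (n - l) (W 0 v) = (\<lambda>T. \<Sum>j\<le>n - l. e j * W j (exp_part s c (n - l - j) v) T)"
          using less False \<open>n \<noteq> 0\<close> by (intro ext) simp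
        then show ?thesis by simp
      qed
      also have "\<dots> = (\<Sum>j\<le>n - l. e j * J (s * int l) (W j (exp_part s c (n - l - j) v)) S)"
        by (rule homog_linear[OF homog_J homog_maya_supp[OF W msh]])
      also have "\<dots> = (\<Sum>j\<le>n - l. e j * W j (J (s * int l) (exp_part s c (n - j - l) v)) S)
          + (\<Sum>j\<le>n - l. a l * e j * W (j + l) (exp_part s c (n - (l + j)) v) S)"
        by (simp add: comm[OF msh] sum.distrib[symmetric] diff_diff_eq add.commute algebra_simps)
      finally show ?thesis
        by (simp only: distrib_left sum_distrib_left) (simp add: mult_ac)
    qed simp
    have "of_nat n * exp_part s c n (W 0 v) S
        = (\<Sum>l\<le>n. of_nat l * c l * J (s * int l) (exp_part s c (n - l) (W 0 v)) S)"
      by (rule exp_part_newton[where c = c, OF s homog_maya_supp[OF W v] c0])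
    \<comment> \<open>In the first double sum the recursion for \<open>exp_part\<close> on v
      collects a factor n - j; in the second, the recursion for e collects a factor k. After
      renaming k to j the two shares add up to n.\<close>
    also have "\<dots> = (\<Sum>l\<le>n. \<Sum>j\<le>n - l. e j * of_nat l * c l * W j (J (s * int l) (exp_part s c (n - j - l) v)) S)
        + (\<Sum>l\<le>n. \<Sum>j\<le>n - l. of_nat l * c l * a l * e j * W (j + l) (exp_part s c (n - (l + j)) v) S)"
      using IH by (simp add: sum.distrib)
    also have "(\<Sum>l\<le>n. \<Sum>j\<le>n - l. e j * of_nat l * c l * W j (J (s * int l) (exp_part s c (n - j - l) v)) S)
        = (\<Sum>j\<le>n. \<Sum>l\<le>n - j. e j * of_nat l * c l * W j (J (s * int l) (exp_part s c (n - j - l) v)) S)"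
      by (rule sum_triangle_swap)
    also have "\<dots> = (\<Sum>j\<le>n. of_nat (n - j) * (e j * W j (exp_part s c (n - j) v) S))"
    proof (intro sum.cong refl)
      fix j
      have "(\<Sum>l\<le>n - j. of_nat l * c l * W j (J (s * int l) (exp_part s c (n - j - l) v)) S)
        = W j (\<lambda>T. \<Sum>l\<le>n - j. of_nat l * c l * J (s * int l) (exp_part s c (n - j - l) v) T) S"
        by (rule homog_linear[OF W homog_maya_supp[OF homog_J msh], symmetric])
      also have "\<dots> = W j (\<lambda>T. of_nat (n - j) * exp_part s c (n - j) v T) S"
        by (simp only: exp_part_newton[where c = c, OF s v c0])
      also have "\<dots> = of_nat (n - j) * W j (exp_part s c (n - j) v) S"
        by (rule homog_smult[OF W msh])
      finally show "(\<Sum>l\<le>n - j. e j * of_nat l * c l * W j (J (s * int l) (exp_part s c (n - j - l) v)) S)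
        = of_nat (n - j) * (e j * W j (exp_part s c (n - j) v) S)"
        by (simp only: mult.assoc sum_distrib_left[symmetric] mult.left_commute[of "e j" "of_nat (n - j)"])
    qed
    also have "(\<Sum>l\<le>n. \<Sum>j\<le>n - l. of_nat l * c l * a l * e j * W (j + l) (exp_part s c (n - (l + j)) v) S)
        = (\<Sum>k\<le>n. \<Sum>l\<le>k. of_nat l * c l * a l * e (k - l) * W (k - l + l) (exp_part s c (n - (l + (k - l))) v) S)"
      by (rule sum_triangle_diagonal)
    also have "\<dots> = (\<Sum>k\<le>n. of_nat k * (e k * W k (exp_part s c (n - k) v) S))"
      by (intro sum.cong refl)
        (simp add: e[unfolded mult.assoc] mult.assoc[symmetric] sum_distrib_right e)
    also have "(\<Sum>j\<le>n. of_nat (n - j) * (e j * W j (exp_part s c (n - j) v) S)) + \<dots>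
        = (\<Sum>j\<le>n. of_nat n * (e j * W j (exp_part s c (n - j) v) S))"
      unfolding sum.distrib[symmetric] distrib_right[symmetric] of_nat_add[symmetric]
      by (intro sum.cong refl) simp
    finally show ?thesis using False by (simp add: sum_distrib_left[symmetric])
  qed
qed

text \<open>The intertwining relation for the family that is one current at index 0 and zero
  afterwards: with a = 0 the series e is the constant 1.\<close>

lemma J_exp_part_commute:
  assumes "s \<noteq> 0" "maya_supp v" "c 0 = 0"
  shows "exp_part s c n (J (s * int l) v) S = J (s * int l) (exp_part s c n v) S"
proof -
  define W where "W j = (if j = 0 then J (s * int l) else (\<lambda>v S. 0))" for j :: nat
  have "exp_part s c n (W 0 v) S = (\<Sum>j\<le>n. of_bool (j = 0) * W j (exp_part s c (n - j) v) S)"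
  proof (rule exp_part_intertwine[where p = "s * int l" and a = "\<lambda>_. 0"])
    show "homog (s * int l + s * int j) (W j)" for j
      by (cases j) (simp_all add: W_def homog_J homog_zero)
    show "J (s * int m) (W j u) S = W j (J (s * int m) u) S + 0 * W (j + m) u S"
      if "maya_supp u" for m j u S
      using J_commute[OF that assms(1)] by (simp add: W_def homog_zero_vec[OF homog_J])
  qed (use assms in auto)
  also have "\<dots> = (\<Sum>j\<in>{0}. of_bool (j = 0) * W j (exp_part s c (n - j) v) S)"
    by (rule sum.mono_neutral_right) auto
  finally show ?thesis by (simp add: W_def)
qed

text \<open>The exponential law. Splitting n as i + (n - i) and applying the recursion to each
  exponential shows that the convolution obeys the recursion with coefficients c + d, which fixes it
  by induction.\<close>

lemma exp_part_add:
  assumes s: "s \<noteq> 0" and v: "maya_supp v" and c0: "c 0 = 0" and d0: "d 0 = 0"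
  shows "exp_part s (\<lambda>l. c l + d l) n v S = (\<Sum>i\<le>n. exp_part s c i (exp_part s d (n - i) v) S)"
proof (induction n arbitrary: S rule: less_induct)
  case (less n)
  have msd: "maya_supp (exp_part s d m v)" for m by (rule homog_maya_supp[OF homog_exp_part v])
  show ?case
  proof (cases "n = 0")
    case True
    have "exp_part s d 0 v = v" by (rule ext) simp
    then show ?thesis by (simp add: True)
  next
    case False
    have 1: "(\<Sum>i\<le>n. of_nat i * exp_part s c i (exp_part s d (n - i) v) S)
      = (\<Sum>l\<le>n. \<Sum>i\<le>n - l. of_nat l * c l * J (s * int l) (exp_part s c i (exp_part s d (n - l - i) v)) S)"
      by (subst sum_triangle_diagonal) (simp add: exp_part_newton[where c = c, OF s msd c0])
    have 2: "of_nat (n - i) * exp_part s c i (exp_part s d (n - i) v) S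
      = (\<Sum>l\<le>n - i. of_nat l * d l * J (s * int l) (exp_part s c i (exp_part s d (n - l - i) v)) S)" for i
    proof -
      have "of_nat (n - i) * exp_part s c i (exp_part s d (n - i) v) S
        = exp_part s c i (\<lambda>T. of_nat (n - i) * exp_part s d (n - i) v T) S"
        by (rule homog_smult[OF homog_exp_part msd, symmetric])
      also have "\<dots> = exp_part s c i (\<lambda>T. \<Sum>l\<le>n - i. of_nat l * d l * J (s * int l) (exp_part s d (n - i - l) v) T) S"
        by (simp only: exp_part_newton[where c = d, OF s v d0])
      also have "\<dots> = (\<Sum>l\<le>n - i. of_nat l * d l * exp_part s c i (J (s * int l) (exp_part s d (n - i - l) v)) S)"
        by (rule homog_linear[OF homog_exp_part homog_maya_supp[OF homog_J msd]])
      finally show ?thesis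
        by (simp add: J_exp_part_commute[where c = c, OF s msd c0] diff_diff_eq add.commute)
    qed
    have "of_nat n * (\<Sum>i\<le>n. exp_part s c i (exp_part s d (n - i) v) S)
      = (\<Sum>i\<le>n. of_nat i * exp_part s c i (exp_part s d (n - i) v) S)
        + (\<Sum>i\<le>n. of_nat (n - i) * exp_part s c i (exp_part s d (n - i) v) S)"
      unfolding sum_distrib_left sum.distrib[symmetric] distrib_right[symmetric] of_nat_add[symmetric]
      by (intro sum.cong refl) simp
    also have "(\<Sum>i\<le>n. of_nat (n - i) * exp_part s c i (exp_part s d (n - i) v) S)
      = (\<Sum>l\<le>n. \<Sum>i\<le>n - l. of_nat l * d l * J (s * int l) (exp_part s c i (exp_part s d (n - l - i) v)) S)"
      unfolding 2 by (rule sum_triangle_swap)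
    also have "(\<Sum>i\<le>n. of_nat i * exp_part s c i (exp_part s d (n - i) v) S) + \<dots>
      = (\<Sum>l\<le>n. of_nat l * (c l + d l) * (\<Sum>i\<le>n - l. J (s * int l) (exp_part s c i (exp_part s d (n - l - i) v)) S))"
      unfolding 1 by (simp add: sum.distrib[symmetric] sum_distrib_left algebra_simps)
    also have "\<dots> = (\<Sum>l\<le>n. of_nat l * (c l + d l) * J (s * int l) (exp_part s (\<lambda>l. c l + d l) (n - l) v) S)"
    proof (intro sum.cong refl)
      fix l
      show "of_nat l * (c l + d l) * (\<Sum>i\<le>n - l. J (s * int l) (exp_part s c i (exp_part s d (n - l - i) v)) S)
        = of_nat l * (c l + d l) * J (s * int l) (exp_part s (\<lambda>l. c l + d l) (n - l) v) S"
      proof (cases "l = 0")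
        case False
        then have "exp_part s (\<lambda>l. c l + d l) (n - l) v
          = (\<lambda>T. \<Sum>i\<le>n - l. 1 * exp_part s c i (exp_part s d (n - l - i) v) T)"
          using less \<open>n \<noteq> 0\<close> by (intro ext) simp
        then show ?thesis
          by (simp only: homog_linear[OF homog_J homog_maya_supp[OF homog_exp_part msd]]) simp
      qed simp
    qed
    also have "\<dots> = of_nat n * exp_part s (\<lambda>l. c l + d l) n v S"
      by (rule exp_part_newton[OF s v, symmetric]) (simp add: c0 d0)
    finally show ?thesis using False by simp
  qed
qed

section \<open>Exponentials on vectors bounded in energy\<close>

text \<open>Arbitrary coefficients put all vertex operators, their inverses, finite products and
  limits into one family, on which products become sums of coefficients.\<close>

definition current :: "int \<Rightarrow> (nat \<Rightarrow> complex) \<Rightarrow> fop" where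
  "current s c v S = (\<Sum>k. c (Suc k) * J (s * int (Suc k)) v S)"

abbreviation exp_current :: "int \<Rightarrow> (nat \<Rightarrow> complex) \<Rightarrow> fop" where
  "exp_current s c \<equiv> op_exp (current s c)"

text \<open>The degrees n are nonnegative, so every summand can only lower s times the energy; the
  bound E survives. This serves powers, currents and exponentials alike.\<close>

lemma bounded_deg_homog_sum:
  assumes "bounded_deg s E v" "\<And>n. homog (s * int n) (X n)" "s * s = 1"
    and Y: "\<And>S N. E - s * energy S \<le> int N \<Longrightarrow> Y S = (\<Sum>n\<le>N. c n * X n v S)"
  shows "bounded_deg s E Y"
  unfolding bounded_deg_def
proof (intro allI impI, rule ccontr)
  fix S assume nz: "Y S \<noteq> 0" and *: "\<not> (maya S \<and> s * energy S \<le> E)"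
  have "X n v S = 0" for n
  proof (rule ccontr)
    assume "X n v S \<noteq> 0"
    moreover have "bounded_deg s (E - int n) (X n v)"
      using homog_bounded_deg[OF assms(2,1), of n] assms(3) by (simp add: mult.assoc[symmetric])
    ultimately show False using * by (auto simp: bounded_deg_def)
  qed
  then show False using nz Y[of S "nat (E - s * energy S)"] by simp
qed

lemma current_sum:
  assumes v: "bounded_deg s E v" and s: "s * s = 1" and c0: "c 0 = 0" and N: "E - s * energy S \<le> int N"
  shows "(\<lambda>k. c (Suc k) * J (s * int (Suc k)) v S) sums (\<Sum>l\<le>N. c l * J (s * int l) v S)"
proof -
  have "J (s * int l) v S = 0" if "N < l" for l
  proof -
    have "s * (s * int l) = int l" using s by (simp add: mult.assoc[symmetric])
    then show ?thesis
      using that N by (intro bdegD[OF homog_bounded_deg[OF homog_J v]]) linarith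
  qed
  then have "(\<lambda>k. c (Suc k) * J (s * int (Suc k)) v S) sums (\<Sum>k<N. c (Suc k) * J (s * int (Suc k)) v S)"
    by (intro sums_finite) (auto simp del: of_nat_Suc)
  also have "(\<Sum>k<N. c (Suc k) * J (s * int (Suc k)) v S) = (\<Sum>l\<le>N. c l * J (s * int l) v S)"
    using c0 by (simp add: sum.atMost_shift)
  finally show ?thesis .
qed

text \<open>The cutoff N is left free for the induction: the current J (s l) reads diagrams whose
  s-energy is larger by l, and there N - l already suffices. The resulting triangular sum is
  regrouped by total degree.\<close>

lemma current_funpow:
  assumes v: "bounded_deg s E v" and s: "s * s = 1" and c0: "c 0 = 0"
  shows "E - s * energy S \<le> int N \<Longrightarrow> (current s c ^^ j) v S = (\<Sum>n\<le>N. pow_part s c j n v S)"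
proof (induction j arbitrary: S N)
  case 0
  have "(\<Sum>n\<le>N. pow_part s c 0 n v S) = (\<Sum>n\<in>{0}. pow_part s c 0 n v S)"
    by (rule sum.mono_neutral_right) auto
  then show ?case by simp
next
  case (Suc j)
  note N = Suc.prems
  have ms: "maya_supp (pow_part s c j n v)" for n
    by (rule homog_maya_supp[OF homog_pow_part bounded_deg_maya_supp[OF v]])
  let ?w = "(current s c ^^ j) v"
  have w: "bounded_deg s E ?w"
    using bounded_deg_homog_sum[OF v homog_pow_part s, of ?w "\<lambda>_. 1"] Suc.IH by simp
  have "(current s c ^^ Suc j) v S = (\<Sum>l\<le>N. c l * J (s * int l) ?w S)"
    using sums_unique[OF current_sum[where c = c, OF w s c0 N]] by (simp add: current_def)
  also have "\<dots> = (\<Sum>l\<le>N. \<Sum>n\<le>N - l. c l * J (s * int l) (pow_part s c j n v) S)"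
  proof (intro sum.cong refl)
    fix l assume "l \<in> {..N}"
    have "J (s * int l) ?w S = J (s * int l) (\<lambda>T. \<Sum>n\<le>N - l. 1 * pow_part s c j n v T) S"
    proof (rule homog_cong[OF homog_J bounded_deg_maya_supp[OF w] maya_supp_sum[OF ms]])
      fix T assume "energy T = energy S + s * int l"
      then have "s * energy T = s * energy S + int l"
        using s by (simp add: distrib_left mult.assoc[symmetric])
      then show "?w T = (\<Sum>n\<le>N - l. 1 * pow_part s c j n v T)"
        using Suc.IH[of T "N - l"] N \<open>l \<in> {..N}\<close> by simp
    qed
    then show "c l * J (s * int l) ?w S = (\<Sum>n\<le>N - l. c l * J (s * int l) (pow_part s c j n v) S)"
      by (simp only: homog_linear[OF homog_J ms]) (simp only: sum_distrib_left mult_1)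
  qed
  also have "\<dots> = (\<Sum>n\<le>N. pow_part s c (Suc j) n v S)"
    by (simp only: sum_triangle_diagonal pow_part.simps)
  finally show ?case .
qed

text \<open>The bound removes all degrees above N, and a power j > N has no component of degree at
  most N. So the exponential series itself is finite in each component.\<close>

lemma exp_current_eq:
  assumes v: "bounded_deg s E v" and s: "s * s = 1" and c0: "c 0 = 0" and N: "E - s * energy S \<le> int N"
  shows "exp_current s c v S = (\<Sum>n\<le>N. exp_part s c n v S)"
proof -
  have "exp_current s c v S = (\<Sum>j. \<Sum>n\<le>N. pow_part s c j n v S / fact j)"
    by (simp add: op_exp_def current_funpow[where c = c, OF v s c0 N] sum_divide_distrib)
  also have "\<dots> = (\<Sum>j\<le>N. \<Sum>n\<le>N. pow_part s c j n v S / fact j)"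
    by (intro suminf_finite) (auto simp: pow_part_eq_0[where c = c, OF c0])
  also have "\<dots> = (\<Sum>n\<le>N. \<Sum>j\<le>N. pow_part s c j n v S / fact j)"
    by (rule sum.swap)
  also have "\<dots> = (\<Sum>n\<le>N. exp_part s c n v S)"
    by (intro sum.cong refl exp_part_ge[where c = c, OF c0, symmetric]) simp
  finally show ?thesis .
qed

lemma exp_current_bounded_deg:
  assumes "bounded_deg s E v" "s * s = 1" "c 0 = 0"
  shows "bounded_deg s E (exp_current s c v)"
  using bounded_deg_homog_sum[OF assms(1) homog_exp_part assms(2), of "exp_current s c v" "\<lambda>_. 1"] exp_current_eq[where c = c, OF assms]
  by simp

lemma homog_exp_current:
  assumes v: "bounded_deg s E v" and s: "s * s = 1" and c0: "c 0 = 0"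
    and X: "homog (p + s * int j) X" and N: "E - s * energy S - s * p \<le> int (N + j)"
  shows "X (exp_current s c v) S = (\<Sum>n\<le>N. X (exp_part s c n v) S)"
proof -
  have ms: "maya_supp (exp_part s c n v)" for n by (rule homog_maya_supp[OF homog_exp_part bounded_deg_maya_supp[OF v]])
  have "X (exp_current s c v) S = X (\<lambda>T. \<Sum>n\<le>N. 1 * exp_part s c n v T) S"
  proof (rule homog_cong[OF X bounded_deg_maya_supp[OF exp_current_bounded_deg[where c = c, OF v s c0]] maya_supp_sum[OF ms]])
    fix T assume "energy T = energy S + (p + s * int j)"
    then have "s * energy T = s * energy S + s * p + int j"
      using s by (simp add: distrib_left mult.assoc[symmetric])
    then show "exp_current s c v T = (\<Sum>n\<le>N. 1 * exp_part s c n v T)"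
      using N by (simp add: exp_current_eq[where c = c, OF v s c0])
  qed
  then show ?thesis by (simp only: homog_linear[OF X ms]) (simp only: mult_1)
qed

lemma exp_current_add:
  assumes v: "bounded_deg s E v" and s: "s * s = 1" and c0: "c 0 = 0" and d0: "d 0 = 0"
  shows "exp_current s c (exp_current s d v) S = exp_current s (\<lambda>l. c l + d l) v S"
proof -
  define N where "N = nat (E - s * energy S)"
  have N: "E - s * energy S \<le> int N" by (simp add: N_def)
  have s0: "s \<noteq> 0" using s by auto
  have "exp_current s c (exp_current s d v) S = (\<Sum>i\<le>N. exp_part s c i (exp_current s d v) S)"
    by (rule exp_current_eq[where c = c, OF exp_current_bounded_deg[where c = d, OF v s d0] s c0 N])
  also have "\<dots> = (\<Sum>i\<le>N. \<Sum>n\<le>N - i. exp_part s c i (exp_part s d n v) S)"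
  proof (intro sum.cong refl)
    fix i assume "i \<in> {..N}"
    then show "exp_part s c i (exp_current s d v) S = (\<Sum>n\<le>N - i. exp_part s c i (exp_part s d n v) S)"
      using N homog_exp_part[of s i c] by (intro homog_exp_current[where c = d, OF v s d0, where p = 0 and j = i]) auto
  qed
  also have "\<dots> = (\<Sum>n\<le>N. exp_part s (\<lambda>l. c l + d l) n v S)"
    by (simp only: sum_triangle_diagonal exp_part_add[where c = c and d = d, OF s0 bounded_deg_maya_supp[OF v] c0 d0])
  also have "\<dots> = exp_current s (\<lambda>l. c l + d l) v S"
    by (rule exp_current_eq[OF v s _ N, symmetric]) (simp add: c0 d0)
  finally show ?thesis .
qed

lemma exp_part_zero_coeffs:
  assumes "s \<noteq> 0" "maya_supp v" "0 < n"
  shows "exp_part s (\<lambda>_. 0) n v S = 0"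
  using exp_part_newton[OF assms(1,2), of "\<lambda>_. 0" n S] assms(3) by simp

lemma exp_current_zero:
  assumes v: "bounded_deg s E v" and s: "s * s = 1"
  shows "exp_current s (\<lambda>_. 0) v S = v S"
proof -
  define N where "N = nat (E - s * energy S)"
  have "exp_current s (\<lambda>_. 0) v S = (\<Sum>n\<le>N. exp_part s (\<lambda>_. 0) n v S)"
    by (rule exp_current_eq[OF v s]) (simp_all add: N_def)
  also have "\<dots> = (\<Sum>n\<in>{0}. exp_part s (\<lambda>_. 0) n v S)"
    using s bounded_deg_maya_supp[OF v]
    by (intro sum.mono_neutral_right) (auto intro!: exp_part_zero_coeffs)
  finally show ?thesis by simp
qed

text \<open>The exponential is carried through \<open>W 0\<close> to the right, where it cancels its
  inverse. Since e vanishes beyond k, the surviving sum has the same length for every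
  diagram.\<close>

lemma exp_current_conjugate:
  assumes v: "bounded_deg s E v" and s: "s * s = 1" and c0: "c 0 = 0" and e0: "e 0 = 1"
    and ek: "\<And>j. k < j \<Longrightarrow> e j = 0"
    and W: "\<And>j. homog (p + s * int j) (W j)"
    and comm: "\<And>l j u S. maya_supp u \<Longrightarrow>
      J (s * int l) (W j u) S = W j (J (s * int l) u) S + a l * W (j + l) u S"
    and e: "\<And>n. of_nat n * e n = (\<Sum>l\<le>n. of_nat l * c l * a l * e (n - l))"
  shows "exp_current s c (W 0 (exp_current s (\<lambda>l. - c l) v)) S = (\<Sum>j\<le>k. e j * W j v S)"
proof -
  let ?u = "exp_current s (\<lambda>l. - c l) v"
  have u: "bounded_deg s E ?u" by (rule exp_current_bounded_deg[OF v s]) (simp add: c0)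
  have s0: "s \<noteq> 0" using s by auto
  have inv: "exp_current s c ?u = v"
    using exp_current_add[where c = c and d = "\<lambda>l. - c l", OF v s c0] exp_current_zero[OF v s] c0 by (intro ext) simp
  \<comment> \<open>\<open>W 0\<close> has degree p, which moves the energy bound to E - s p; the
    maximum with k makes the cutoff include every nonzero e j.\<close>
  define N where "N = max k (nat (E - s * p - s * energy S))"
  have N: "E - s * p - s * energy S \<le> int N" by (simp add: N_def)
  have "bounded_deg s (E - s * p) (W 0 ?u)"
    using homog_bounded_deg[OF W[of 0] u] by simp
  then have "exp_current s c (W 0 ?u) S = (\<Sum>n\<le>N. exp_part s c n (W 0 ?u) S)"
    by (rule exp_current_eq[where c = c, OF _ s c0 N])
  also have "\<dots> = (\<Sum>n\<le>N. \<Sum>j\<le>n. e j * W j (exp_part s c (n - j) ?u) S)"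
    by (intro sum.cong refl exp_part_intertwine[where p = p and a = a] s0 bounded_deg_maya_supp[OF u] c0 e0 W comm e)
  also have "\<dots> = (\<Sum>j\<le>N. \<Sum>i\<le>N - j. e j * W j (exp_part s c i ?u) S)"
    by (rule sum_triangle_diagonal[symmetric])
  also have "\<dots> = (\<Sum>j\<le>N. e j * W j (exp_current s c ?u) S)"
  proof (intro sum.cong refl)
    fix j assume "j \<in> {..N}"
    then have "W j (exp_current s c ?u) S = (\<Sum>i\<le>N - j. W j (exp_part s c i ?u) S)"
      using N by (intro homog_exp_current[where c = c, OF u s c0 W]) simp
    then show "(\<Sum>i\<le>N - j. e j * W j (exp_part s c i ?u) S) = e j * W j (exp_current s c ?u) S"
      by (simp only: sum_distrib_left)
  qed
  also have "\<dots> = (\<Sum>j\<le>k. e j * W j v S)"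
    unfolding inv using ek by (intro sum.mono_neutral_right) (auto simp: N_def)
  finally show ?thesis .
qed

lemma pow_part_tendsto:
  assumes v: "maya_supp v" and c: "\<And>l. (\<lambda>N. c N l) \<longlonglongrightarrow> d l"
  shows "(\<lambda>N. pow_part s (c N) j n v S) \<longlonglongrightarrow> pow_part s d j n v S"
proof (induction j arbitrary: n S)
  case (Suc j)
  have "(\<lambda>N. J (s * int l) (pow_part s (c N) j m v) S) \<longlonglongrightarrow> J (s * int l) (pow_part s d j m v) S" for l m
    by (rule homog_tendsto[OF homog_J homog_maya_supp[OF homog_pow_part v] homog_maya_supp[OF homog_pow_part v] Suc])
  then show ?case unfolding pow_part.simps by (intro tendsto_intros c)
qed simp

text \<open>For a fixed diagram the cutoff depends on v alone, so all exponentials in the sequence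
  are the same finite expression in finitely many coefficients.\<close>

lemma exp_current_tendsto:
  assumes v: "bounded_deg s E v" and s: "s * s = 1" and c0: "\<And>N. c N 0 = 0" and d0: "d 0 = 0"
    and c: "\<And>l. (\<lambda>N. c N l) \<longlonglongrightarrow> d l"
  shows "(\<lambda>N. exp_current s (c N) v S) \<longlonglongrightarrow> exp_current s d v S"
proof -
  define N where "N = nat (E - s * energy S)"
  have N: "E - s * energy S \<le> int N" by (simp add: N_def)
  show ?thesis
    unfolding exp_current_eq[where c = "c _", OF v s c0 N] exp_current_eq[where c = d, OF v s d0 N] exp_part_def
    by (intro tendsto_intros pow_part_tendsto[OF bounded_deg_maya_supp[OF v] c]) simp
qed

subsection \<open>The modes V and the products at q^-rho\<close>

text \<open>The subtracted constant is minus the sum of q^(kn) over n \<open>\<le>\<close> 0, continued analytically in q^k;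
  it removes the normal ordering and with it the central term.\<close>

definition V_shifted :: "complex \<Rightarrow> complex \<Rightarrow> int \<Rightarrow> int \<Rightarrow> fop" where
  "V_shifted q r k m v S = Vop q r k m v S - q powi k / (1 - q powi k) * of_bool (m = 0) * v S"

lemma homog_diff:
  assumes "homog k X" "maya_supp u" "maya_supp w"
  shows "X (\<lambda>T. a * u T - b * w T) S = a * X u S - b * X w S"
proof -
  have "X (\<lambda>T. \<Sum>i\<in>UNIV. (if i then a else - b) * (if i then u else w) T) S
    = (\<Sum>i\<in>UNIV. (if i then a else - b) * X (if i then u else w) S)"
    by (rule homog_linear[OF assms(1)]) (use assms in auto)
  then show ?thesis by (simp add: UNIV_bool add.commute)
qed

lemma shiftop_scale: "shiftop m (\<lambda>n. c * f n) v S = c * shiftop m f v S"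
  by (simp add: shiftop_def mult.assoc infsum_cmult_right')

lemma V_shifted_eq_shiftop:
  "V_shifted q r k m v = (\<lambda>S. r powi (- k * m) * shiftop m (\<lambda>n. q powi (k * n)) v S
     - q powi k / (1 - q powi k) * of_bool (m = 0) * v S)"
  by (rule ext) (simp add: V_shifted_def Vop_eq_shiftop)

lemma homog_V_shifted: "homog m (V_shifted q r k m)"
proof -
  let ?a = "q powi k / (1 - q powi k) * of_bool (m = 0)"
  have "homog m (\<lambda>v S. - ?a * v S)"
    using homog_scale[OF homog_id, of "\<lambda>_. - ?a"] homog_zero by (cases "m = 0") simp_all
  then have "homog m (\<lambda>v S. r powi (- k * m) * shiftop m (\<lambda>n. q powi (k * n)) v S + (- ?a) * v S)"
    by (rule homog_add[OF homog_scale[OF homog_shiftop]])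
  then show ?thesis by (simp add: V_shifted_eq_shiftop[abs_def])
qed

text \<open>Replacing f n by f n - f (n - l) multiplies the geometric amplitude by 1 - q^(-kl); the
  prefactor r^(-km) makes this r^(kl) - r^(-kl). The central term has the same factor and supplies
  precisely the constant of the mode m + l = 0.\<close>

lemma V_shifted_commutator:
  assumes r: "r \<noteq> 0" "r ^ 2 = q" and k: "q powi k \<noteq> 1" and v: "maya_supp v"
  shows "J l (V_shifted q r k m v) S = V_shifted q r k m (J l v) S
     + (r powi (k * l) - r powi (- (k * l))) * V_shifted q r k (m + l) v S"
proof -
  have q: "q \<noteq> 0" using r by auto
  have q_powi: "q powi x = r powi (2 * x)" for x
    using r(2) by (simp add: power_int_mult)
  have k': "1 - q powi (- k) \<noteq> 0"
    using k by (simp add: power_int_minus)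
  let ?f = "\<lambda>n. q powi (k * n)"
  \<comment> \<open>The closed form of the sum of q^(ki) over i \<le> n, which is a primitive of
    \<open>?f\<close> also where that series diverges. Its value at 0 is minus the constant
    subtracted in \<open>V_shifted\<close>.\<close>
  let ?F = "\<lambda>n. ?f n / (1 - q powi (- k))"
  let ?A = "shiftop m ?f" and ?a = "q powi k / (1 - q powi k) * of_bool (m = 0)"
  have F: "?f n = ?F n - ?F (n - 1)" for n
  proof -
    have "?f (n - 1) = ?f n * q powi (- k)"
      using q by (simp add: power_int_add[symmetric] algebra_simps)
    then have "?F n - ?F (n - 1) = (?f n - ?f n * q powi (- k)) / (1 - q powi (- k))"
      by (simp only: diff_divide_distrib)
    also have "\<dots> = ?f n * (1 - q powi (- k)) / (1 - q powi (- k))"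
      by (simp only: right_diff_distrib mult_1_right)
    finally show ?thesis by (simp only: nonzero_mult_div_cancel_right[OF k'])
  qed
  have f_shift: "?f n - ?f (n - l) = (1 - q powi (- (k * l))) * ?f n" for n
  proof -
    have "?f (n - l) = ?f n * q powi (- (k * l))"
      using q by (simp add: power_int_add[symmetric] algebra_simps)
    then show ?thesis by (simp add: algebra_simps)
  qed
  have "J l (V_shifted q r k m v) S - V_shifted q r k m (J l v) S
      = r powi (- k * m) * (shiftop l (\<lambda>_. 1) (?A v) S - ?A (shiftop l (\<lambda>_. 1) v) S)"
    unfolding V_shifted_eq_shiftop
    by (subst homog_diff[OF homog_J homog_maya_supp[OF homog_shiftop v] v]) (simp add: J_eq algebra_simps)
  also have "\<dots> = r powi (- k * m) * ((1 - q powi (- (k * l))) * shiftop (l + m) ?f v S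
      + of_bool (l + m = 0) * (?F 0 - ?F (- l)) * v S)"
    by (simp only: shiftop_commutator[OF v, where F = ?F, OF F] f_shift shiftop_scale)
  also have "\<dots> = (r powi (k * l) - r powi (- (k * l))) * V_shifted q r k (m + l) v S"
  proof -
    have 1: "r powi (- k * m) * (1 - q powi (- (k * l)))
        = (r powi (k * l) - r powi (- (k * l))) * r powi (- k * (m + l))"
      using r(1) by (simp add: q_powi left_diff_distrib right_diff_distrib power_int_add[symmetric])
        (simp add: algebra_simps)
    have 2: "r powi (- k * m) * (of_bool (l + m = 0) * (?F 0 - ?F (- l)) * v S)
        = - ((r powi (k * l) - r powi (- (k * l)))
            * (q powi k / (1 - q powi k) * of_bool (m + l = 0) * v S))"
    proof (cases "l + m = 0")
      case True
      then have m: "m = - l" by simp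
      have "1 / (1 - q powi (- k)) = - (q powi k / (1 - q powi k))"
        using q k k' by (simp add: power_int_minus field_simps)
      then have "?F 0 - ?F (- l) = (1 - q powi (- (k * l))) * - (q powi k / (1 - q powi k))"
        by (simp add: diff_divide_distrib left_diff_distrib divide_inverse)
      then show ?thesis using 1 m by (simp add: mult.assoc[symmetric])
    qed simp
    show ?thesis
      unfolding V_shifted_eq_shiftop right_diff_distrib[of "r powi (k * l) - r powi (- (k * l))"]
        distrib_left[of "r powi (- k * m)"] mult.assoc[symmetric] 1[unfolded mult.assoc[symmetric]]
      using 2 by (simp add: add.commute mult.assoc)
  qed
  finally show ?thesis by (simp add: algebra_simps)
qed

section \<open>Vertex operators at q^-rho as exponentials of currents\<close>

lemma current_bounded_deg:
  assumes "bounded_deg s E v" "s * s = 1" "c 0 = 0"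
  shows "bounded_deg s E (current s c v)"
proof (rule bounded_deg_homog_sum[OF assms(1) homog_J assms(2)])
  show "current s c v S = (\<Sum>n\<le>N. c n * J (s * int n) v S)" if "E - s * energy S \<le> int N" for S N
    using current_sum[where c = c, OF assms that] by (simp add: current_def sums_iff)
qed

lemma op_exp_op_neg:
  assumes v: "bounded_deg s E v" and s: "s * s = 1" and c0: "c 0 = 0"
  shows "op_exp (op_neg (current s c)) v = exp_current s (\<lambda>l. - c l) v"
proof -
  have neg: "op_neg (current s c) u = current s (\<lambda>l. - c l) u" if u: "bounded_deg s E u" for u
  proof
    fix S
    define N where "N = nat (E - s * energy S)"
    have N: "E - s * energy S \<le> int N" by (simp add: N_def)
    show "op_neg (current s c) u S = current s (\<lambda>l. - c l) u S"
      using current_sum[where c = c, OF u s c0 N] current_sum[where c = "\<lambda>l. - c l", OF u s _ N] c0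
      by (simp add: op_neg_def current_def sums_iff sum_negf)
  qed
  have "(op_neg (current s c) ^^ j) v = (current s (\<lambda>l. - c l) ^^ j) v
      \<and> bounded_deg s E ((current s (\<lambda>l. - c l) ^^ j) v)" for j
    by (induction j) (use v s c0 in \<open>auto simp: neg intro!: current_bounded_deg\<close>)
  then show ?thesis by (simp add: op_exp_def)
qed

lemma Jsum_eq_current: "Jsum s z = current s (\<lambda>l. z ^ l / of_nat l)"
  by (intro ext) (simp add: Jsum_def current_def)

text \<open>Here d is the sign of the exponent and t the sign of the argument: the pairs (1,1),
  (-1,1), (-1,-1) and (1,-1) give Gamma, its inverse, Gamma' and its inverse.\<close>

lemma opprod_eq_exp_current:
  assumes s: "s * s = 1"
    and G: "\<And>z u. bounded_deg s E u \<Longrightarrow> G z u = exp_current s (\<lambda>l. d * (t * z) ^ l / of_nat l) u"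
  shows "bounded_deg s E v \<Longrightarrow>
    opprod G q r N v = exp_current s (\<lambda>l. \<Sum>i<N. d * (t * (q ^ i * r)) ^ l / of_nat l) v"
proof (induction N arbitrary: v)
  case 0
  then show ?case using exp_current_zero[OF 0 s] by (intro ext) simp
next
  case (Suc N)
  let ?c = "\<lambda>l. \<Sum>i<N. d * (t * (q ^ i * r)) ^ l / of_nat l"
  let ?d = "\<lambda>l. d * (t * (q ^ N * r)) ^ l / of_nat l"
  have "bounded_deg s E (exp_current s ?d v)"
    by (rule exp_current_bounded_deg[OF Suc.prems s]) simp
  then have "opprod G q r (Suc N) v = exp_current s ?c (exp_current s ?d v)"
    by (simp add: G[OF Suc.prems] Suc.IH)
  also have "\<dots> = exp_current s (\<lambda>l. ?c l + ?d l) v"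
    by (rule ext, rule exp_current_add[OF Suc.prems s]) simp_all
  finally show ?case by simp
qed

text \<open>The coefficients of the partial products are partial geometric sums in q^l, whose limit
  puts 1 - q^l into the denominator. Convergence of the coefficients is enough for componentwise
  convergence of the operators.\<close>

lemma at_rho_eq_exp_current:
  assumes s: "s * s = 1" and q: "cmod q < 1" and v: "bounded_deg s E v"
    and G: "\<And>z u. bounded_deg s E u \<Longrightarrow> G z u = exp_current s (\<lambda>l. d * (t * z) ^ l / of_nat l) u"
  shows "at_rho G q r v = exp_current s (\<lambda>l. d * (t * r) ^ l / ((1 - q ^ l) * of_nat l)) v"
proof
  fix S
  have "(\<lambda>N. \<Sum>i<N. d * (t * (q ^ i * r)) ^ l / of_nat l)
      \<longlonglongrightarrow> d * (t * r) ^ l / ((1 - q ^ l) * of_nat l)" for l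
  proof (cases "l = 0")
    case False
    then have "cmod (q ^ l) < 1"
      using q by (simp add: norm_power power_less_one_iff)
    then have "(\<lambda>i. (q ^ l) ^ i) sums (1 / (1 - q ^ l))"
      by (rule geometric_sums)
    then have "(\<lambda>i. d * (t * r) ^ l / of_nat l * (q ^ l) ^ i) sums
        (d * (t * r) ^ l / of_nat l * (1 / (1 - q ^ l)))"
      by (rule sums_mult)
    moreover have "d * (t * r) ^ l / of_nat l * (q ^ l) ^ i = d * (t * (q ^ i * r)) ^ l / of_nat l" for i
      by (simp add: power_mult_distrib power_mult[symmetric] mult.commute)
    moreover have "d * (t * r) ^ l / of_nat l * (1 / (1 - q ^ l))
        = d * (t * r) ^ l / ((1 - q ^ l) * of_nat l)"
      by simp
    ultimately show ?thesis by (simp only: sums_def)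
  qed simp
  then have "(\<lambda>N. exp_current s (\<lambda>l. \<Sum>i<N. d * (t * (q ^ i * r)) ^ l / of_nat l) v S)
      \<longlonglongrightarrow> exp_current s (\<lambda>l. d * (t * r) ^ l / ((1 - q ^ l) * of_nat l)) v S"
    by (rule exp_current_tendsto[OF v s, rotated 2]) simp_all
  moreover have "opprod G q r N v = exp_current s (\<lambda>l. \<Sum>i<N. d * (t * (q ^ i * r)) ^ l / of_nat l) v" for N
    by (rule opprod_eq_exp_current[OF s G v])
  ultimately have "(\<lambda>N. opprod G q r N v S) \<longlonglongrightarrow> exp_current s (\<lambda>l. d * (t * r) ^ l / ((1 - q ^ l) * of_nat l)) v S"
    by simp
  then show "at_rho G q r v S = exp_current s (\<lambda>l. d * (t * r) ^ l / ((1 - q ^ l) * of_nat l)) v S"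
    unfolding at_rho_def by (rule limI)
qed

section \<open>The polynomial produced by conjugation\<close>

text \<open>Newton's identities, from the logarithmic derivative: x P' = - Q P, where Q is the
  generating series of the power sums of the a i without constant term. In the induction a new
  factor 1 - a x adds a x / (1 - a x) to Q.\<close>

lemma prod_linear_newton:
  fixes a :: "nat \<Rightarrow> complex"
  defines "P \<equiv> \<lambda>k. \<Prod>i<k. [:1, - a i:]"
  shows "of_nat n * coeff (P k) n = (\<Sum>l\<le>n. - (of_bool (0 < l) * (\<Sum>i<k. a i ^ l)) * coeff (P k) (n - l))"
proof -
  define Q where "Q k = Abs_fps (\<lambda>l. of_bool (0 < l) * (\<Sum>i<k. a i ^ l))" for k :: nat
  have "fps_X * fps_deriv (fps_of_poly (P k)) = - Q k * fps_of_poly (P k)"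
  proof (induction k)
    case 0
    have "Q 0 = 0" by (rule fps_ext) (simp add: Q_def)
    then show ?case by (simp add: P_def)
  next
    case (Suc k)
    define L where "L = 1 - fps_const (a k) * fps_X"
    define R where "R = Abs_fps (\<lambda>l. of_bool (0 < l) * a k ^ l)"
    have P: "fps_of_poly (P (Suc k)) = fps_of_poly (P k) * L"
      by (simp add: P_def L_def fps_of_poly_mult fps_of_poly_linear' mult.commute)
    have Q: "Q (Suc k) = Q k + R"
      by (rule fps_ext) (simp add: Q_def R_def distrib_left)
    have L': "fps_deriv L = - fps_const (a k)"
      by (simp add: L_def)
    have R: "R * L = fps_const (a k) * fps_X"
    proof (rule fps_ext)
      fix n
      have "R * L = R - fps_const (a k) * (fps_X * R)"
        by (simp add: L_def algebra_simps)
      then show "fps_nth (R * L) n = fps_nth (fps_const (a k) * fps_X) n"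
        by (cases n) (auto simp: R_def)
    qed
    have "fps_X * fps_deriv (fps_of_poly (P k) * L)
        = (fps_X * fps_deriv (fps_of_poly (P k))) * L - fps_of_poly (P k) * (fps_const (a k) * fps_X)"
      by (simp add: L' algebra_simps)
    also have "\<dots> = - (Q k + R) * (fps_of_poly (P k) * L)"
      unfolding Suc R[symmetric] by (simp add: algebra_simps)
    finally show ?case unfolding P Q .
  qed
  then have "fps_nth (fps_X * fps_deriv (fps_of_poly (P k))) n = fps_nth (- Q k * fps_of_poly (P k)) n"
    by simp
  moreover have "fps_nth (fps_X * fps_deriv F) n = of_nat n * fps_nth F n" for F :: "complex fps"
    by (cases n) simp_all
  ultimately have "of_nat n * coeff (P k) n = - fps_nth (Q k * fps_of_poly (P k)) n"
    by simp
  then show ?thesis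
    by (simp add: fps_mult_nth Q_def atLeast0AtMost sum_negf)
qed

text \<open>Reversal turns 1 - a x into x - a = - a (1 - x / a). As a i and a (k - 1 - i) are
  inverse to each other, this permutes the factors up to scalars.\<close>

lemma prod_linear_palindromic:
  fixes a :: "nat \<Rightarrow> complex"
  assumes a: "\<And>i. i < k \<Longrightarrow> a (k - Suc i) * a i = 1" and j: "j \<le> k"
  shows "coeff (\<Prod>i<k. [:1, - a i:]) (k - j) = (\<Prod>i<k. - a i) * coeff (\<Prod>i<k. [:1, - a i:]) j"
proof -
  let ?P = "\<Prod>i<k. [:1, - a i:]"
  have nz: "a i \<noteq> 0" if "i < k" for i using a[OF that] by auto
  have deg: "degree ?P = k"
    using nz by (subst degree_prod_eq_sum_degree) auto
  have "reflect_poly ?P = (\<Prod>i<k. reflect_poly [:1, - a i:])"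
    by (rule reflect_poly_prod)
  also have "\<dots> = (\<Prod>i<k. smult (- a i) [:1, - a (k - Suc i):])"
  proof (intro prod.cong refl)
    fix i assume "i \<in> {..<k}"
    then show "reflect_poly [:1, - a i:] = smult (- a i) [:1, - a (k - Suc i):]"
      using nz[of i] a[of i] by (simp add: reflect_poly_pCons' monom_Suc monom_0 mult.commute)
  qed
  also have "\<dots> = smult (\<Prod>i<k. - a i) (\<Prod>i<k. [:1, - a (k - Suc i):])"
    by (rule prod_smult)
  also have "(\<Prod>i<k. [:1, - a (k - Suc i):]) = ?P"
    by (rule prod.nat_diff_reindex)
  finally have "coeff (reflect_poly ?P) j = (\<Prod>i<k. - a i) * coeff ?P j"
    by simp
  then show ?thesis using deg j by (simp add: coeff_reflect_poly)
qed

lemma coeff_prod_linear: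
  fixes a :: "nat \<Rightarrow> complex"
  shows "coeff (\<Prod>i<k. [:1, - a i:]) 0 = 1"
    and "k < j \<Longrightarrow> coeff (\<Prod>i<k. [:1, - a i:]) j = 0"
proof -
  show "coeff (\<Prod>i<k. [:1, - a i:]) 0 = 1"
    by (induction k) (simp_all add: coeff_mult)
  have "degree (\<Prod>i<k. [:1, - a i:]) \<le> (\<Sum>i<k. degree [:1, - a i:])"
    using degree_prod_sum_le[of "{..<k}" "\<lambda>i. [:1, - a i:]"] by (simp add: o_def)
  also have "\<dots> \<le> (\<Sum>i<k. 1)" by (intro sum_mono) simp
  finally show "k < j \<Longrightarrow> coeff (\<Prod>i<k. [:1, - a i:]) j = 0"
    by (intro coeff_eq_0) simp
qed

lemma prod_powi_centred:
  fixes r :: complex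
  assumes "r \<noteq> 0"
  shows "(\<Prod>i<k. r powi (2 * int i + 1 - int k)) = 1"
proof -
  \<comment> \<open>The number of factors is separated from the centre so that induction is
    possible; for n and c both equal to k the exponent is 0.\<close>
  have "(\<Prod>i<n. r powi (2 * int i + 1 - c)) = r powi (int n * (int n - c))" for n c
  proof (induction n)
    case (Suc n)
    then show ?case using assms by (simp add: power_int_add[symmetric]) (simp add: algebra_simps)
  qed simp
  then show ?thesis by simp
qed

text \<open>A geometric sum of ratio r^(2l), with its denominator multiplied out to meet the factor
  1 - q^l of the vertex operators.\<close>

lemma sum_powi_centred:
  fixes r :: complex
  assumes "r \<noteq> 0"
  shows "(1 - (r ^ 2) ^ l) * (\<Sum>i<k. (r powi (2 * int i + 1 - int k)) ^ l)
    = r ^ l * (r powi (- (int k * int l)) - r powi (int k * int l))"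
proof -
  have "(r powi (2 * int i + 1 - int k)) ^ l = r powi (int l * (1 - int k)) * ((r ^ 2) ^ l) ^ i" for i
  proof -
    have "((r ^ 2) ^ l) ^ i = r powi (2 * int l * int i)"
      by (simp only: power_mult[symmetric]) (simp only: power_int_of_nat[symmetric] of_nat_mult of_nat_numeral)
    moreover have "(r powi (2 * int i + 1 - int k)) ^ l = r powi (int l * (2 * int i + 1 - int k))"
      by (simp only: mult.commute[of "int l"] power_int_mult power_int_of_nat)
    ultimately show ?thesis
      using assms by (simp add: power_int_add[symmetric]) (simp add: algebra_simps)
  qed
  then have "(1 - (r ^ 2) ^ l) * (\<Sum>i<k. (r powi (2 * int i + 1 - int k)) ^ l)
    = r powi (int l * (1 - int k)) * (1 - ((r ^ 2) ^ l) ^ k)"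
    by (simp add: sum_distrib_left[symmetric] one_diff_power_eq mult.left_commute)
  also have "((r ^ 2) ^ l) ^ k = r powi (2 * int l * int k)"
    by (simp only: power_mult[symmetric]) (simp only: power_int_of_nat[symmetric] of_nat_mult of_nat_numeral)
  also have "r powi (int l * (1 - int k)) * (1 - r powi (2 * int l * int k))
    = r powi int l * (r powi (- (int k * int l)) - r powi (int k * int l))"
    using assms
    by (simp add: right_diff_distrib power_int_add[symmetric] del: power_int_of_nat)
      (simp add: algebra_simps)
  finally show ?thesis by simp
qed

section \<open>Conjugation of V and its symmetry\<close>

text \<open>The hypothesis on c says that the logarithm of the conjugation factor has minus the
  power sums of the a i as its Newton data, so the factor is the product of the 1 - a i x, with x
  acting as the shift of the mode number by s.\<close>

lemma V_shifted_conjugate: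
  assumes r: "r \<noteq> 0" "r ^ 2 = q" and K: "q powi K \<noteq> 1"
    and s: "s * s = 1" and v: "bounded_deg s E v" and c0: "c 0 = 0"
    and c: "\<And>l. of_nat l * c l * (r powi (K * (s * int l)) - r powi (- (K * (s * int l))))
      = - (of_bool (0 < l) * (\<Sum>i<k. a i ^ l))"
  shows "exp_current s c (V_shifted q r K m (exp_current s (\<lambda>l. - c l) v)) S
    = (\<Sum>j\<le>k. coeff (\<Prod>i<k. [:1, - a i:]) j * V_shifted q r K (m + s * int j) v S)"
proof -
  define W where "W j = V_shifted q r K (m + s * int j)" for j :: nat
  have W0: "V_shifted q r K m = W 0" by (simp add: W_def)
  show ?thesis unfolding W0 W_def[symmetric]
  proof (rule exp_current_conjugate[OF v s, where p = m
        and a = "\<lambda>l. r powi (K * (s * int l)) - r powi (- (K * (s * int l)))"])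
    show "homog (m + s * int j) (W j)" for j
      unfolding W_def by (rule homog_V_shifted)
    show "J (s * int l) (W j u) S = W j (J (s * int l) u) S
        + (r powi (K * (s * int l)) - r powi (- (K * (s * int l)))) * W (j + l) u S"
      if "maya_supp u" for l j u S
      unfolding W_def V_shifted_commutator[OF r K that] by (simp add: algebra_simps)
    show "of_nat n * coeff (\<Prod>i<k. [:1, - a i:]) n = (\<Sum>l\<le>n. of_nat l * c l *
        (r powi (K * (s * int l)) - r powi (- (K * (s * int l)))) * coeff (\<Prod>i<k. [:1, - a i:]) (n - l))" for n
      unfolding c by (rule prod_linear_newton)
  qed (simp_all add: c0 coeff_prod_linear)
qed

text \<open>Passing from s = 1 to s = -1 flips the sign of r^(kl) - r^(-kl), and the inverse flips
  the sign of c, so both conjugations have the same coefficients. One runs upwards from m, the other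
  downwards from m + k; the palindromic symmetry matches them. Here \<epsilon> = 1 belongs to (i)
  and \<epsilon> = -1 to (ii).\<close>

lemma V_shifted_conjugate_symmetry:
  fixes \<epsilon> :: int
  assumes r: "r \<noteq> 0" "r ^ 2 = q" and q: "cmod q < 1" and \<epsilon>: "\<epsilon> = 1 \<or> \<epsilon> = - 1"
    and K: "q powi (\<epsilon> * int k) \<noteq> 1" and v: "bounded_deg 1 E v" "bounded_deg (- 1) E' v"
  defines "c \<equiv> \<lambda>l. of_int \<epsilon> * (of_int \<epsilon> * r) ^ l / ((1 - q ^ l) * of_nat l)"
  shows "exp_current 1 c (V_shifted q r (\<epsilon> * int k) m (exp_current 1 (\<lambda>l. - c l) v)) S
    = (- of_int \<epsilon>) ^ k * exp_current (- 1) (\<lambda>l. - c l) (V_shifted q r (\<epsilon> * int k) (m + int k) (exp_current (- 1) c v)) S"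
proof -
  define a where "a i = of_int \<epsilon> * r powi (2 * int i + 1 - int k)" for i
  let ?e = "coeff (\<Prod>i<k. [:1, - a i:])"
  have c0: "c 0 = 0" by (simp add: c_def)
  have c: "of_nat l * c l * (r powi (\<epsilon> * int k * int l) - r powi (- (\<epsilon> * int k * int l)))
      = - (of_bool (0 < l) * (\<Sum>i<k. a i ^ l))" for l
  proof (cases "l = 0")
    case False
    have "cmod (q ^ l) < 1"
      using q False by (simp add: norm_power power_less_one_iff)
    then have ql: "1 - q ^ l \<noteq> 0" by auto
    have "(1 - q ^ l) * (\<Sum>i<k. a i ^ l)
        = of_int \<epsilon> ^ l * (r ^ l * (r powi (- (int k * int l)) - r powi (int k * int l)))"
      using sum_powi_centred[OF r(1), of l k]
      by (simp add: a_def power_mult_distrib r(2) sum_distrib_left[symmetric] mult.left_commute)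
    \<comment> \<open>The difference of powers is odd in the upper index of V, which absorbs the
      leading sign in c.\<close>
    also have "\<dots> = - (of_int \<epsilon> * (of_int \<epsilon> * r) ^ l * (r powi (\<epsilon> * int k * int l) - r powi (- (\<epsilon> * int k * int l))))"
      using \<epsilon> by (auto simp: power_mult_distrib algebra_simps)
    also have "\<dots> = - ((1 - q ^ l) * (of_nat l * c l * (r powi (\<epsilon> * int k * int l) - r powi (- (\<epsilon> * int k * int l)))))"
      using ql False by (simp add: c_def)
    finally have "(1 - q ^ l) * (of_nat l * c l * (r powi (\<epsilon> * int k * int l) - r powi (- (\<epsilon> * int k * int l))))
        = (1 - q ^ l) * - (\<Sum>i<k. a i ^ l)"
      by simp
    from mult_left_cancel[OF ql, THEN iffD1, OF this] show ?thesis using False by simp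
  qed simp
  have \<epsilon>2: "of_int \<epsilon> * of_int \<epsilon> = (1 :: complex)" using \<epsilon> by auto
  have pal: "?e (k - j) = (- of_int \<epsilon>) ^ k * ?e j" if "j \<le> k" for j
  proof -
    have "a (k - Suc i) * a i = 1" if "i < k" for i
    proof -
      have "r powi (2 * int (k - Suc i) + 1 - int k) * r powi (2 * int i + 1 - int k) = 1"
        using that r(1) by (simp add: power_int_add[symmetric] of_nat_diff)
      moreover have "a (k - Suc i) * a i = of_int \<epsilon> * of_int \<epsilon>
          * (r powi (2 * int (k - Suc i) + 1 - int k) * r powi (2 * int i + 1 - int k))"
        by (simp add: a_def)
      ultimately show ?thesis using \<epsilon>2 by simp
    qed
    then have "?e (k - j) = (\<Prod>i<k. - a i) * ?e j"
      using that by (rule prod_linear_palindromic)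
    also have "(\<Prod>i<k. - a i) = (- of_int \<epsilon>) ^ k"
    proof -
      have "(\<Prod>i<k. - a i) = (\<Prod>i<k. - of_int \<epsilon> * r powi (2 * int i + 1 - int k))"
        by (simp add: a_def)
      also have "\<dots> = (\<Prod>i<k. - of_int \<epsilon>) * (\<Prod>i<k. r powi (2 * int i + 1 - int k))"
        by (rule prod.distrib)
      finally show ?thesis by (simp add: prod_powi_centred[OF r(1)])
    qed
    finally show ?thesis .
  qed
  have "exp_current (- 1) (\<lambda>l. - c l) (V_shifted q r (\<epsilon> * int k) (m + int k) (exp_current (- 1) (\<lambda>l. - (- c l)) v)) S
    = (\<Sum>j\<le>k. ?e j * V_shifted q r (\<epsilon> * int k) (m + int k + (- 1) * int j) v S)"
  proof (rule V_shifted_conjugate[OF r K _ v(2)])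
    show "of_nat l * - c l * (r powi (\<epsilon> * int k * (- 1 * int l)) - r powi (- (\<epsilon> * int k * (- 1 * int l))))
      = - (of_bool (0 < l) * (\<Sum>i<k. a i ^ l))" for l
      unfolding c[symmetric] by (simp add: algebra_simps)
  qed (simp_all add: c0)
  also have "\<dots> = (\<Sum>j\<le>k. ?e (k - j) * V_shifted q r (\<epsilon> * int k) (m + int j) v S)"
    by (rule sum.reindex_bij_witness[where i = "\<lambda>j. k - j" and j = "\<lambda>j. k - j"])
      (auto simp: of_nat_diff add_diff_eq)
  also have "\<dots> = (- of_int \<epsilon>) ^ k * (\<Sum>j\<le>k. ?e j * V_shifted q r (\<epsilon> * int k) (m + int j) v S)"
    by (simp add: pal sum_distrib_left mult.assoc)
  also have "(\<Sum>j\<le>k. ?e j * V_shifted q r (\<epsilon> * int k) (m + int j) v S)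
      = exp_current 1 c (V_shifted q r (\<epsilon> * int k) m (exp_current 1 (\<lambda>l. - c l) v)) S"
    by (subst V_shifted_conjugate[OF r K _ v(1), where a = a and k = k]) (simp_all add: c0 c)
  finally show ?thesis
    using \<epsilon>2 by (simp add: mult.assoc[symmetric] power_mult_distrib[symmetric])
qed

lemma finvec_bounded_deg:
  assumes "finvec v"
  obtains E where "bounded_deg 1 E v" "bounded_deg (- 1) 0 v"
proof -
  have "finite (energy ` {S. v S \<noteq> 0})" using assms by (simp add: finvec_def)
  then have "bdd_above (energy ` {S. v S \<noteq> 0})" by (rule bdd_above_finite)
  then obtain E where "\<And>S. v S \<noteq> 0 \<Longrightarrow> energy S \<le> E"
    unfolding bdd_above_def by auto
  then have "bounded_deg 1 E v" "bounded_deg (- 1) 0 v"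
    using assms energy_nonneg by (auto simp: bounded_deg_def finvec_def)
  then show thesis by (rule that)
qed

section \<open>Conjugation by q^(W_0/2)\<close>

lemma basis_apply: "basis S T = of_bool (T = S)"
  by (simp add: basis_def)

text \<open>A diagonal normal-ordered bilinear multiplies by the occupation number minus that of the
  vacuum, so only particles above the sea and holes in it contribute, with opposite signs.\<close>

lemma W0_basis:
  assumes "maya S"
  shows "W0 (basis S) = (\<lambda>T. of_int (weight (\<lambda>n. n ^ 2) S) * basis S T)"
proof
  fix T
  have W0: "W0 (basis S) T = (\<Sum>\<^sub>\<infinity>n. of_int (n ^ 2) * normal_bilin n n (basis S) T)"
    by (simp add: W0_def nbil_eq_normal_bilin)
  show "W0 (basis S) T = of_int (weight (\<lambda>n. n ^ 2) S) * basis S T"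
  proof (cases "T = S")
    case False
    then have "normal_bilin n n (basis S) T = 0" for n
      by (simp add: normal_bilin_def psic_psia_same basis_apply)
    then show ?thesis using False by (simp add: W0 basis_apply)
  next
    case True
    let ?A = "S - {..0}" and ?B = "{..0} - S"
    have fin: "finite ?A" "finite ?B" using assms by (auto simp: maya_def)
    have "W0 (basis S) T = (\<Sum>\<^sub>\<infinity>n. of_int (n ^ 2) * (of_bool (n \<in> S) - of_bool (n \<le> 0)))"
      unfolding W0 using True assms by (simp add: normal_bilin_same basis_apply)
    also have "\<dots> = (\<Sum>\<^sub>\<infinity>n\<in>?A \<union> ?B. of_int (n ^ 2) * (of_bool (n \<in> S) - of_bool (n \<le> 0)))"
      by (intro infsum_cong_neutral) auto
    also have "\<dots> = (\<Sum>n\<in>?A \<union> ?B. of_int (n ^ 2) * (of_bool (n \<in> S) - of_bool (n \<le> 0)))"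
      using fin by simp
    also have "\<dots> = (\<Sum>n\<in>?A. of_int (n ^ 2) * (of_bool (n \<in> S) - of_bool (n \<le> 0)))
        + (\<Sum>n\<in>?B. of_int (n ^ 2) * (of_bool (n \<in> S) - of_bool (n \<le> 0)))"
      using fin by (intro sum.union_disjoint) auto
    also have "(\<Sum>n\<in>?A. of_int (n ^ 2) * (of_bool (n \<in> S) - of_bool (n \<le> 0))) = (\<Sum>n\<in>?A. of_int (n ^ 2) :: complex)"
      by (intro sum.cong) auto
    also have "(\<Sum>n\<in>?B. of_int (n ^ 2) * (of_bool (n \<in> S) - of_bool (n \<le> 0))) = - (\<Sum>n\<in>?B. of_int (n ^ 2) :: complex)"
      unfolding sum_negf[symmetric] by (intro sum.cong) auto
    finally show ?thesis using True basis_apply[of S S] by (simp add: weight_def)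
  qed
qed

lemma qW0half_maya:
  assumes "maya S"
  shows "qW0half r e v S = r powi (e * weight (\<lambda>n. n ^ 2) S) * v S"
proof -
  have "(THE w::int. W0 (basis S) = (\<lambda>T. of_int w * basis S T)) = weight (\<lambda>n. n ^ 2) S"
  proof (rule the_equality)
    fix w :: int
    assume "W0 (basis S) = (\<lambda>T. of_int w * basis S T)"
    from fun_cong[OF this, of S] show "w = weight (\<lambda>n. n ^ 2) S"
      by (simp add: W0_basis[OF assms] basis_apply)
  qed (rule W0_basis[OF assms])
  then show ?thesis by (simp add: qW0half_def)
qed

text \<open>Moving a particle from n to n - m changes the sum of squares by m^2 - 2nm. The part
  linear in n contributes q^(-nm), which turns k into k - m under the sum; the rest, r^(m^2),
  corrects the prefactor accordingly.\<close>

lemma qW0half_conjugate_Vop: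
  assumes r: "r \<noteq> 0" "r ^ 2 = q" and S: "maya S"
  shows "qW0half r 1 (Vop q r k m (qW0half r (- 1) v)) S = Vop q r (k - m) m v S"
proof -
  let ?w = "weight (\<lambda>n. n ^ 2)"
  have q_powi: "q powi x = r powi (2 * x)" for x
    using r(2) by (simp add: power_int_mult)
  have normal_bilin: "normal_bilin (n - m) n (qW0half r (- 1) v) S
      = r powi (- ?w S) * r powi (m ^ 2 - 2 * n * m) * normal_bilin (n - m) n v S" for n
  proof (cases "m = 0")
    case True
    then show ?thesis using S by (simp add: normal_bilin_same qW0half_maya)
  next
    case False
    have "- (?w S + n ^ 2 - (n - m) ^ 2) = - ?w S + (m ^ 2 - 2 * n * m)"
      by (simp add: power2_eq_square algebra_simps)
    then have "r powi (- (?w S + n ^ 2 - (n - m) ^ 2)) = r powi (- ?w S) * r powi (m ^ 2 - 2 * n * m)"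
      using r(1) by (simp only: power_int_add simp_thms)
    then show ?thesis
      using False S by (auto simp: normal_bilin_diff qW0half_maya weight_move)
  qed
  have "qW0half r 1 (Vop q r k m (qW0half r (- 1) v)) S
    = r powi ?w S * (r powi (- k * m) *
        (\<Sum>\<^sub>\<infinity>n. q powi (k * n) * normal_bilin (n - m) n (qW0half r (- 1) v) S))"
    by (simp add: qW0half_maya[OF S] Vop_eq_shiftop shiftop_def)
  also have "(\<lambda>n. q powi (k * n) * normal_bilin (n - m) n (qW0half r (- 1) v) S)
    = (\<lambda>n. r powi (- ?w S + m ^ 2) * (q powi ((k - m) * n) * normal_bilin (n - m) n v S))"
  proof
    fix n
    have "q powi (k * n) * (r powi (- ?w S) * r powi (m ^ 2 - 2 * n * m))
      = r powi (- ?w S + m ^ 2) * q powi ((k - m) * n)"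
      using r(1) by (simp add: q_powi power_int_add[symmetric]) (simp add: algebra_simps)
    then show "q powi (k * n) * normal_bilin (n - m) n (qW0half r (- 1) v) S
      = r powi (- ?w S + m ^ 2) * (q powi ((k - m) * n) * normal_bilin (n - m) n v S)"
      unfolding normal_bilin mult.assoc[symmetric] by simp
  qed
  also have "(\<Sum>\<^sub>\<infinity>n. r powi (- ?w S + m ^ 2) * (q powi ((k - m) * n) * normal_bilin (n - m) n v S))
    = r powi (- ?w S + m ^ 2) * shiftop m (\<lambda>n. q powi ((k - m) * n)) v S"
    by (simp only: infsum_cmult_right' shiftop_def)
  also have "r powi ?w S * (r powi (- k * m) * (r powi (- ?w S + m ^ 2) * X)) = r powi (- (k - m) * m) * X"
    for X
  proof -
    have "r powi ?w S * r powi (- k * m) * r powi (- ?w S + m ^ 2) = r powi (- (k - m) * m)"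
      using r(1) by (simp add: power_int_add[symmetric]) (simp add: algebra_simps power2_eq_square)
    then show ?thesis by (simp only: mult.assoc[symmetric])
  qed
  finally show ?thesis by (simp only: Vop_eq_shiftop[of q r "k - m" m v S])
qed

theorem theorem1:
  fixes q r :: complex
  assumes "0 < cmod q" and "cmod q < 1" and "r ^ 2 = q"
  shows
   "(\<forall>k m v S. 0 < k \<longrightarrow> finvec v \<longrightarrow> maya S \<longrightarrow>
       (at_rho Gamma_plus q r
         \<circ> (\<lambda>w T. Vop q r k m w T - q powi k / (1 - q powi k) * of_bool (m = 0) * w T)
         \<circ> at_rho Gamma_plus_inv q r) v S
     = (-1) ^ nat k *
       (at_rho Gamma_minus_inv q r
         \<circ> (\<lambda>w T. Vop q r k (m + k) w T - q powi k / (1 - q powi k) * of_bool (m + k = 0) * w T)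
         \<circ> at_rho Gamma_minus q r) v S)
  \<and> (\<forall>k m v S. 0 < k \<longrightarrow> finvec v \<longrightarrow> maya S \<longrightarrow>
       (at_rho Gamma_plus' q r
         \<circ> (\<lambda>w T. Vop q r (- k) m w T + 1 / (1 - q powi k) * of_bool (m = 0) * w T)
         \<circ> at_rho Gamma_plus'_inv q r) v S
     = (at_rho Gamma_minus'_inv q r
         \<circ> (\<lambda>w T. Vop q r (- k) (m + k) w T + 1 / (1 - q powi k) * of_bool (m + k = 0) * w T)
         \<circ> at_rho Gamma_minus' q r) v S)
  \<and> (\<forall>k m v S. finvec v \<longrightarrow> maya S \<longrightarrow>
       (qW0half r 1 \<circ> Vop q r k m \<circ> qW0half r (-1)) v S = Vop q r (k - m) m v S)"
proof (intro conjI allI impI)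
  have r: "r \<noteq> 0" using assms by auto
  have q0: "q \<noteq> 0" using assms by auto
  have q1: "q powi (int k) \<noteq> 1" if "0 < k" for k
  proof -
    have "cmod (q ^ k) < 1"
      using that assms(2) by (simp add: norm_power power_less_one_iff)
    then show ?thesis by auto
  qed
  have q1': "q powi (- int k) \<noteq> 1" if "0 < k" for k
    using q1[OF that] by (simp add: power_int_minus)
  have plus: "at_rho Gamma_plus q r u = exp_current 1 (\<lambda>l. r ^ l / ((1 - q ^ l) * of_nat l)) u"
    "at_rho Gamma_plus_inv q r u = exp_current 1 (\<lambda>l. - (r ^ l / ((1 - q ^ l) * of_nat l))) u"
    "at_rho Gamma_plus' q r u = exp_current 1 (\<lambda>l. - ((- r) ^ l / ((1 - q ^ l) * of_nat l))) u"
    "at_rho Gamma_plus'_inv q r u = exp_current 1 (\<lambda>l. (- r) ^ l / ((1 - q ^ l) * of_nat l)) u"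
    if "bounded_deg 1 E u" for E u
    using at_rho_eq_exp_current[OF _ assms(2) that, of Gamma_plus 1 1 r]
      at_rho_eq_exp_current[OF _ assms(2) that, of Gamma_plus_inv "- 1" 1 r]
      at_rho_eq_exp_current[OF _ assms(2) that, of Gamma_plus' "- 1" "- 1" r]
      at_rho_eq_exp_current[OF _ assms(2) that, of Gamma_plus'_inv 1 "- 1" r]
    by (simp_all add: Gamma_plus_def Gamma_plus_inv_def Gamma_plus'_def Gamma_plus'_inv_def
        Jsum_eq_current op_exp_op_neg[where s = 1])
  have minus: "at_rho Gamma_minus q r u = exp_current (- 1) (\<lambda>l. r ^ l / ((1 - q ^ l) * of_nat l)) u"
    "at_rho Gamma_minus_inv q r u = exp_current (- 1) (\<lambda>l. - (r ^ l / ((1 - q ^ l) * of_nat l))) u"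
    "at_rho Gamma_minus' q r u = exp_current (- 1) (\<lambda>l. - ((- r) ^ l / ((1 - q ^ l) * of_nat l))) u"
    "at_rho Gamma_minus'_inv q r u = exp_current (- 1) (\<lambda>l. (- r) ^ l / ((1 - q ^ l) * of_nat l)) u"
    if "bounded_deg (- 1) E u" for E u
    using at_rho_eq_exp_current[OF _ assms(2) that, of Gamma_minus 1 1 r]
      at_rho_eq_exp_current[OF _ assms(2) that, of Gamma_minus_inv "- 1" 1 r]
      at_rho_eq_exp_current[OF _ assms(2) that, of Gamma_minus' "- 1" "- 1" r]
      at_rho_eq_exp_current[OF _ assms(2) that, of Gamma_minus'_inv 1 "- 1" r]
    by (simp_all add: Gamma_minus_def Gamma_minus_inv_def Gamma_minus'_def Gamma_minus'_inv_def
        Jsum_eq_current op_exp_op_neg[where s = "- 1"])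
  {
    fix k m :: int and v S
    assume k: "0 < k" and v: "finvec v"
    obtain n where n: "k = int n" "0 < n" using k using zero_less_imp_eq_int by blast
    obtain E where E: "bounded_deg 1 E v" "bounded_deg (- 1) 0 v" using finvec_bounded_deg[OF v] .
    have V_shifted: "(\<lambda>w T. Vop q r k m w T - q powi k / (1 - q powi k) * of_bool (m = 0) * w T) = V_shifted q r k m" for m
      by (intro ext) (simp add: V_shifted_def)
    have Vt': "(\<lambda>w T. Vop q r (- k) m w T + 1 / (1 - q powi k) * of_bool (m = 0) * w T) = V_shifted q r (- k) m" for m
    proof -
      \<comment> \<open>At upper index -k the continued constant q^(-k) / (1 - q^(-k)) equals -1 /
        (1 - q^k), so (ii) concerns the same shifted modes as (i).\<close>
      have "1 / (1 - q powi k) = - (q powi (- k) / (1 - q powi (- k)))"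
        using q0 q1[OF n(2)] q1'[OF n(2)] n(1) by (simp add: power_int_minus field_simps)
      then show ?thesis by (intro ext) (simp add: V_shifted_def)
    qed
    \<comment> \<open>After the inner vertex operator the vector may have infinitely many
      components; the one-sided bound is what allows the outer product at q^-rho to be
      evaluated.\<close>
    have bd: "bounded_deg s (E - s * m) (V_shifted q r k m (exp_current s c u))"
      if "bounded_deg s E u" "s * s = 1" "c 0 = 0" for s E u k m c
      by (rule homog_bounded_deg[OF homog_V_shifted exp_current_bounded_deg[where c = c, OF that]])
    show "(at_rho Gamma_plus q r
         \<circ> (\<lambda>w T. Vop q r k m w T - q powi k / (1 - q powi k) * of_bool (m = 0) * w T)
         \<circ> at_rho Gamma_plus_inv q r) v S
     = (-1) ^ nat k *
       (at_rho Gamma_minus_inv q r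
         \<circ> (\<lambda>w T. Vop q r k (m + k) w T - q powi k / (1 - q powi k) * of_bool (m + k = 0) * w T)
         \<circ> at_rho Gamma_minus q r) v S"
      unfolding V_shifted o_apply plus(2)[OF E(1)] minus(1)[OF E(2)]
      by (subst plus(1)[OF bd[OF E(1)]], simp, simp,
          subst minus(2)[OF bd[OF E(2)]], simp, simp)
        (use V_shifted_conjugate_symmetry[OF r assms(3,2), of 1 n E v 0 m S] E q1[OF n(2)] n(1) in simp)
    show "(at_rho Gamma_plus' q r
         \<circ> (\<lambda>w T. Vop q r (- k) m w T + 1 / (1 - q powi k) * of_bool (m = 0) * w T)
         \<circ> at_rho Gamma_plus'_inv q r) v S
     = (at_rho Gamma_minus'_inv q r
         \<circ> (\<lambda>w T. Vop q r (- k) (m + k) w T + 1 / (1 - q powi k) * of_bool (m + k = 0) * w T)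
         \<circ> at_rho Gamma_minus' q r) v S"
      unfolding Vt' o_apply plus(4)[OF E(1)] minus(3)[OF E(2)]
      by (subst plus(3)[OF bd[OF E(1)]], simp, simp,
          subst minus(4)[OF bd[OF E(2)]], simp, simp)
        (use V_shifted_conjugate_symmetry[OF r assms(3,2), of "- 1" n E v 0 m S] E q1'[OF n(2)] n(1) in simp)
  }
  show "(qW0half r 1 \<circ> Vop q r k m \<circ> qW0half r (-1)) v S = Vop q r (k - m) m v S"
    if "maya S" for k m v S
    using qW0half_conjugate_Vop[OF r assms(3) that] by simp
qed

end
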